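(* Let $\mathbb{F}$ be an algebraically closed field with $\mathrm{char}\,\mathbb{F}=2$ and $n\ge1$. Then $S_n^{(8)}$ is a separating set for $\mathbb{F}[\mathbf{O}^n]^{{\rm G}_2}$.
   Context: The split octonion algebra $\mathbf{O}$ is the 8-dimensional $\mathbb{F}$-vector space of formal matrices $a=\begin{pmatrix}\alpha&\mathbf{u}\\ \mathbf{v}&\beta\end{pmatrix}$ with $\alpha,\beta\in\mathbb{F}$, $\mathbf{u},\mathbf{v}\in\mathbb{F}^3$, with multiplication $\begin{pmatrix}\alpha&\mathbf{u}\\ \mathbf{v}&\beta\end{pmatrix}\begin{pmatrix}\alpha'&\mathbf{u}'\\ \mathbf{v}'&\beta'\end{pmatrix}=\begin{pmatrix}\alpha\alpha'+\mathbf{u}\cdot\mathbf{v}'&\alpha\mathbf{u}'+\beta'\mathbf{u}-\mathbf{v}\times\mathbf{v}'\\ \alpha'\mathbf{v}+\beta\mathbf{v}'+\mathbf{u}\times\mathbf{u}'&\beta\beta'+\mathbf{v}\cdot\mathbf{u}'\end{pmatrix}$ (dot product and cross product on $\mathbb{F}^3$). Trace $\mathrm{tr}(a)=\alpha+\beta$, norm $n(a)=\alpha\beta-\mathbf{u}\cdot\mathbf{v}$. ${\rm G}_2=\mathrm{Aut}(\mathbf{O})$ acts diagonally on $\mathbf{O}^n$ and on the coordinate ring $\mathbb{F}[\mathbf{O}^n]$ by $(gf)(\underline{a})=f(g^{-1}\underline{a})$; $\mathbb{F}[\mathbf{O}^n]^{{\rm G}_2}$ is the invariant ring. $S_n$ is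 the set of polynomial functions on $\mathbf{O}^n$ consisting of $\underline{a}\mapsto n(a_i)$ ($1\le i\le n$, degree $2$) and $\underline{a}\mapsto\mathrm{tr}((\cdots((a_{i_1}a_{i_2})a_{i_3})\cdots)a_{i_k})$ for $k\ge1$, $1\le i_1<\cdots<i_k\le n$ (degree $k$); $S_n^{(8)}$ is its subset of elements of degree at most $8$. A subset $S\subseteq\mathbb{F}[\mathbf{O}^n]^{{\rm G}_2}$ is separating if for all $\underline{u},\underline{v}\in\mathbf{O}^n$ such that $f(\underline{u})\ne f(\underline{v})$ for some $f\in\mathbb{F}[\mathbf{O}^n]^{{\rm G}_2}$, there is $f\in S$ with $f(\underline{u})\ne f(\underline{v})$. *)

theory Defs
  imports "HOL-Computational_Algebra.Polynomial"
begin

text \<open>Split octonions as formal matrices (alpha, u, v, beta), u = (u1,u2,u3), v = (v1,v2,v3).\<close>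
datatype 'a oct = Oct (oa: 'a) (ou1: 'a) (ou2: 'a) (ou3: 'a) (ov1: 'a) (ov2: 'a) (ov3: 'a) (ob: 'a)

definition dot3 :: "'a::comm_ring_1 \<times> 'a \<times> 'a \<Rightarrow> 'a \<times> 'a \<times> 'a \<Rightarrow> 'a" where
  "dot3 x y = (case x of (x1,x2,x3) \<Rightarrow> case y of (y1,y2,y3) \<Rightarrow> x1*y1 + x2*y2 + x3*y3)"

definition cross3 :: "'a::comm_ring_1 \<times> 'a \<times> 'a \<Rightarrow> 'a \<times> 'a \<times> 'a \<Rightarrow> 'a \<times> 'a \<times> 'a" where
  "cross3 x y = (case x of (x1,x2,x3) \<Rightarrow> case y of (y1,y2,y3) \<Rightarrow>
      (x2*y3 - x3*y2, x3*y1 - x1*y3, x1*y2 - x2*y1))"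

definition add3 :: "'a::comm_ring_1 \<times> 'a \<times> 'a \<Rightarrow> 'a \<times> 'a \<times> 'a \<Rightarrow> 'a \<times> 'a \<times> 'a" where
  "add3 x y = (case x of (x1,x2,x3) \<Rightarrow> case y of (y1,y2,y3) \<Rightarrow> (x1+y1, x2+y2, x3+y3))"

definition scal3 :: "'a::comm_ring_1 \<Rightarrow> 'a \<times> 'a \<times> 'a \<Rightarrow> 'a \<times> 'a \<times> 'a" where
  "scal3 c x = (case x of (x1,x2,x3) \<Rightarrow> (c*x1, c*x2, c*x3))"

definition neg3 :: "'a::comm_ring_1 \<times> 'a \<times> 'a \<Rightarrow> 'a \<times> 'a \<times> 'a" where
  "neg3 x = scal3 (-1) x"

definition ovec_u :: "'a oct \<Rightarrow> 'a \<times> 'a \<times> 'a" where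
  "ovec_u a = (ou1 a, ou2 a, ou3 a)"

definition ovec_v :: "'a oct \<Rightarrow> 'a \<times> 'a \<times> 'a" where
  "ovec_v a = (ov1 a, ov2 a, ov3 a)"

definition mk_oct :: "'a \<Rightarrow> 'a \<times> 'a \<times> 'a \<Rightarrow> 'a \<times> 'a \<times> 'a \<Rightarrow> 'a \<Rightarrow> 'a oct" where
  "mk_oct al u v be = (case u of (u1,u2,u3) \<Rightarrow> case v of (v1,v2,v3) \<Rightarrow> Oct al u1 u2 u3 v1 v2 v3 be)"

definition omul :: "'a::comm_ring_1 oct \<Rightarrow> 'a oct \<Rightarrow> 'a oct" where
  "omul a a' = mk_oct
     (oa a * oa a' + dot3 (ovec_u a) (ovec_v a'))
     (add3 (add3 (scal3 (oa a) (ovec_u a')) (scal3 (ob a') (ovec_u a))) (neg3 (cross3 (ovec_v a) (ovec_v a'))))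
     (add3 (add3 (scal3 (oa a') (ovec_v a)) (scal3 (ob a) (ovec_v a'))) (cross3 (ovec_u a) (ovec_u a')))
     (ob a * ob a' + dot3 (ovec_v a) (ovec_u a'))"

definition oadd :: "'a::comm_ring_1 oct \<Rightarrow> 'a oct \<Rightarrow> 'a oct" where
  "oadd a b = Oct (oa a + oa b) (ou1 a + ou1 b) (ou2 a + ou2 b) (ou3 a + ou3 b)
                  (ov1 a + ov1 b) (ov2 a + ov2 b) (ov3 a + ov3 b) (ob a + ob b)"

definition osmult :: "'a::comm_ring_1 \<Rightarrow> 'a oct \<Rightarrow> 'a oct" where
  "osmult c a = Oct (c * oa a) (c * ou1 a) (c * ou2 a) (c * ou3 a)
                    (c * ov1 a) (c * ov2 a) (c * ov3 a) (c * ob a)"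

definition otr :: "'a::comm_ring_1 oct \<Rightarrow> 'a" where
  "otr a = oa a + ob a"

definition onorm :: "'a::comm_ring_1 oct \<Rightarrow> 'a" where
  "onorm a = oa a * ob a - dot3 (ovec_u a) (ovec_v a)"

definition G2 :: "('a::comm_ring_1 oct \<Rightarrow> 'a oct) set" where
  "G2 = {g. bij g \<and> (\<forall>x y. g (oadd x y) = oadd (g x) (g y))
            \<and> (\<forall>c x. g (osmult c x) = osmult c (g x))
            \<and> (\<forall>x y. g (omul x y) = omul (g x) (g y))}"

definition ocoord :: "nat \<Rightarrow> 'a oct \<Rightarrow> 'a" where
  "ocoord j a = [oa a, ou1 a, ou2 a, ou3 a, ov1 a, ov2 a, ov3 a, ob a] ! j"

text \<open>Points of O^n are represented by functions nat => oct; only the entries with index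
  i < n (i.e. a_1..a_n as a_0..a_{n-1}) are used. Polynomial functions on O^n:
  generated by constants and the 8n coordinate functions under + and *.\<close>
inductive_set poly_fun :: "nat \<Rightarrow> ((nat \<Rightarrow> 'a::comm_ring_1 oct) \<Rightarrow> 'a) set" for n where
  const: "(\<lambda>_. c) \<in> poly_fun n"
| coord: "i < n \<Longrightarrow> j < 8 \<Longrightarrow> (\<lambda>a. ocoord j (a i)) \<in> poly_fun n"
| add: "f \<in> poly_fun n \<Longrightarrow> h \<in> poly_fun n \<Longrightarrow> (\<lambda>a. f a + h a) \<in> poly_fun n"
| mult: "f \<in> poly_fun n \<Longrightarrow> h \<in> poly_fun n \<Longrightarrow> (\<lambda>a. f a * h a) \<in> poly_fun n"

definition inv_ring :: "nat \<Rightarrow> ((nat \<Rightarrow> 'a::comm_ring_1 oct) \<Rightarrow> 'a) set" where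
  "inv_ring n = {f \<in> poly_fun n. \<forall>g \<in> G2. \<forall>a. f (\<lambda>i. inv g (a i)) = f a}"

definition lnprod :: "(nat \<Rightarrow> 'a::comm_ring_1 oct) \<Rightarrow> nat list \<Rightarrow> 'a oct" where
  "lnprod a is = foldl (\<lambda>x i. omul x (a i)) (a (hd is)) (tl is)"

definition S8 :: "nat \<Rightarrow> ((nat \<Rightarrow> 'a::comm_ring_1 oct) \<Rightarrow> 'a) set" where
  "S8 n = {(\<lambda>a. onorm (a i)) | i. i < n}
        \<union> {(\<lambda>a. otr (lnprod a is)) | is. is \<noteq> [] \<and> length is \<le> 8
              \<and> sorted_wrt (<) is \<and> (\<forall>i \<in> set is. i < n)}"

definition separating :: "nat \<Rightarrow> ((nat \<Rightarrow> 'a::comm_ring_1 oct) \<Rightarrow> 'a) set \<Rightarrow> bool" where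
  "separating n S \<longleftrightarrow> S \<subseteq> inv_ring n \<and>
     (\<forall>u v. (\<exists>f \<in> inv_ring n. f u \<noteq> f v) \<longrightarrow> (\<exists>f \<in> S. f u \<noteq> f v))"

end

theory Submission
  imports Defs
begin

text \<open>
  A polynomial invariant does not change when a tuple is replaced by its limit under a one-parameter
  subgroup of G2. If the unital algebra generated by the tuple contains a nonzero x with
  n(x) = 0 that is orthogonal to the whole algebra, then x can be moved to a root vector, the
  algebra lies in a parabolic subalgebra, and such a limit moves the tuple into 2 by 2 matrices and,
  if necessary, further into diagonal ones. So every tuple has the same invariants as one generating
  an algebra on which the norm is nondegenerate.

  Let u and v be two such tuples on which S8 agrees. Modulo products of traces of smaller degree,
  the trace of a left-normed word is alternating in its letters, so agreement on increasing words
  gives agreement on all words of length at most 8. A chain of subspaces in an 8-dimensional space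
  starting with the constants stabilises after 7 steps, hence left-normed words of length at most 7
  span each of the two algebras, and by nondegeneracy u and v satisfy the same linear relations
  together with 1. Among 1 and 8 letters there always is one, which reduces the
  trace of a longer word to words with a repeated letter. Thus all traces agree, and p(u) \<mapsto> p(v) is a
  well-defined isomorphism of algebras. It extends to an element of G2: in characteristic 2 an algebra without elements of nonzero trace
  consists of scalars, and otherwise one can bring an idempotent and then
  a dual pair of off-diagonal elements into standard position; if they do not generate the
  algebra, the algebra is everything.
\<close>

section \<open>Identities for octonions\<close>

definition oone :: "'a::comm_ring_1 oct" where
  "oone = Oct 1 0 0 0 0 0 0 1"

definition ozero :: "'a::comm_ring_1 oct" where
  "ozero = Oct 0 0 0 0 0 0 0 0"

text \<open>The polar form n(x + y) - n(x) - n(y), see \<open>onorm_oadd\<close>, written with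
  traces so that it is determined by traces of words.\<close>

definition opolar :: "'a::comm_ring_1 oct \<Rightarrow> 'a oct \<Rightarrow> 'a" where
  "opolar x y = otr x * otr y - otr (omul x y)"

text \<open>The value of xy + yx, see \<open>omul_anticommute\<close>, obtained by linearising x^2 =
  tr(x) x - n(x). Being a combination of x, y and 1, it shortens words.\<close>

definition osym :: "'a::comm_ring_1 oct \<Rightarrow> 'a oct \<Rightarrow> 'a oct" where
  "osym x y = oadd (oadd (osmult (otr x) y) (osmult (otr y) x)) (osmult (- opolar x y) oone)"

lemma omul_Oct [simp]:
  "omul (Oct a u1 u2 u3 v1 v2 v3 b) (Oct a' u1' u2' u3' v1' v2' v3' b') =
     Oct (a * a' + (u1 * v1' + u2 * v2' + u3 * v3'))
       (a * u1' + b' * u1 - (v2 * v3' - v3 * v2'))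
       (a * u2' + b' * u2 - (v3 * v1' - v1 * v3'))
       (a * u3' + b' * u3 - (v1 * v2' - v2 * v1'))
       (a' * v1 + b * v1' + (u2 * u3' - u3 * u2'))
       (a' * v2 + b * v2' + (u3 * u1' - u1 * u3'))
       (a' * v3 + b * v3' + (u1 * u2' - u2 * u1'))
       (b * b' + (v1 * u1' + v2 * u2' + v3 * u3'))"
  by (simp add: omul_def mk_oct_def dot3_def cross3_def add3_def scal3_def neg3_def
      ovec_u_def ovec_v_def)

lemma oadd_Oct [simp]:
  "oadd (Oct a u1 u2 u3 v1 v2 v3 b) (Oct a' u1' u2' u3' v1' v2' v3' b') =
     Oct (a + a') (u1 + u1') (u2 + u2') (u3 + u3') (v1 + v1') (v2 + v2') (v3 + v3') (b + b')"
  by (simp add: oadd_def)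

lemma osmult_Oct [simp]:
  "osmult c (Oct a u1 u2 u3 v1 v2 v3 b) =
     Oct (c * a) (c * u1) (c * u2) (c * u3) (c * v1) (c * v2) (c * v3) (c * b)"
  by (simp add: osmult_def)

lemma otr_Oct [simp]: "otr (Oct a u1 u2 u3 v1 v2 v3 b) = a + b"
  by (simp add: otr_def)

lemma onorm_Oct [simp]:
  "onorm (Oct a u1 u2 u3 v1 v2 v3 b) = a * b - (u1 * v1 + u2 * v2 + u3 * v3)"
  by (simp add: onorm_def dot3_def ovec_u_def ovec_v_def)

lemma oadd_ozero [simp]: "oadd ozero x = x" "oadd x ozero = x"
  by (cases x; simp add: ozero_def)+

lemma omul_ozero [simp]: "omul ozero x = ozero" "omul x ozero = ozero"
  by (cases x; simp add: ozero_def)+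

lemma omul_oone [simp]: "omul oone x = x" "omul x oone = x"
  by (cases x; simp add: oone_def)+

lemma osmult_simps [simp]: "osmult 0 x = ozero" "osmult 1 x = x" "osmult c ozero = ozero"
    "osmult c (osmult d x) = osmult (c * d) x"
  by (cases x; simp add: ozero_def mult.assoc)+

lemma onorm_simps [simp]: "onorm ozero = 0" "onorm oone = 1" "onorm (osmult c x) = c\<^sup>2 * onorm x"
  by (cases x; simp add: ozero_def oone_def power2_eq_square algebra_simps)+

lemma otr_simps [simp]: "otr ozero = 0" "otr oone = 1 + 1" "otr (osmult c x) = c * otr x"
    "otr (oadd x y) = otr x + otr y"
  by (cases x; cases y; simp add: ozero_def oone_def algebra_simps)+

lemma omul_linear [simp]:
  "omul (oadd x y) z = oadd (omul x z) (omul y z)"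
  "omul z (oadd x y) = oadd (omul z x) (omul z y)"
  "omul (osmult c x) z = osmult c (omul x z)"
  "omul z (osmult c x) = osmult c (omul z x)"
  by (cases x; cases y; cases z; simp add: algebra_simps)+

lemma oadd_osmult_neg: "oadd x (osmult (-1) y) = ozero \<longleftrightarrow> x = y"
  by (cases x; cases y; simp add: ozero_def)

lemma otr_commute: "otr (omul x y) = otr (omul y x)"
  by (cases x; cases y; simp add: algebra_simps)

lemma otr_assoc: "otr (omul (omul x y) z) = otr (omul x (omul y z))"
  by (cases x; cases y; cases z; simp add: algebra_simps)

lemma onorm_omul: "onorm (omul x y) = onorm x * onorm y"
  by (cases x; cases y; simp add: algebra_simps)

lemma onorm_oadd: "onorm (oadd x y) = onorm x + onorm y + opolar x y"
  by (cases x; cases y; simp add: opolar_def algebra_simps)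

lemma omul_self: "omul x x = oadd (osmult (otr x) x) (osmult (- onorm x) oone)"
  by (cases x; simp add: oone_def algebra_simps)

lemma omul_anticommute: "oadd (omul x y) (omul y x) = osym x y"
  by (cases x; cases y; simp add: osym_def opolar_def oone_def algebra_simps)

lemma omul_right_alternative: "omul (omul x y) y = omul x (omul y y)"
  by (cases x; cases y; simp add: algebra_simps)

lemma omul_right_alternative_linear:
  "oadd (omul (omul x y) z) (omul (omul x z) y) = omul x (osym y z)"
  by (cases x; cases y; cases z; simp add: osym_def opolar_def oone_def algebra_simps)

lemma omul_left_alternative_linear:
  "oadd (omul x (omul y z)) (omul y (omul x z)) = omul (osym x y) z"
  by (cases x; cases y; cases z; simp add: osym_def opolar_def oone_def algebra_simps)

text \<open>Applies in turn x(yz) = (xy + yx)z - y(xz), then y(xz) = (y(xz) + (xz)y) - (xz)y, then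
  (xz)y = x(yz + zy) - (xy)z. If z is a letter, the right side needs only xy and right
  multiplications by z, which suits an induction on the length of the right factor.\<close>

lemma omul_reassociate:
  "omul x (omul y z) = oadd (oadd (oadd (omul (osym x y) z) (omul x (osym y z)))
      (osmult (-1) (osym y (omul x z)))) (osmult (-1) (omul (omul x y) z))"
proof -
  have cancel: "p = oadd s (osmult (-1) q)" if "oadd p q = s" for p q s :: "'a oct"
    using that by (cases p; cases q; cases s; simp add: algebra_simps)
  have cancel': "q = oadd s (osmult (-1) p)" if "oadd p q = s" for p q s :: "'a oct"
    using that by (cases p; cases q; cases s; simp add: algebra_simps)
  have comb: "oadd a (osmult (-1) (oadd b (osmult (-1) (oadd c (osmult (-1) d))))) =
      oadd (oadd (oadd a c) (osmult (-1) b)) (osmult (-1) d)" for a b c d :: "'a oct"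
    by (cases a; cases b; cases c; cases d; simp add: algebra_simps)
  show ?thesis
    using cancel[OF omul_left_alternative_linear[of x y z]] cancel[OF omul_anticommute[of y "omul x z"]]
      cancel'[OF omul_right_alternative_linear[of x y z]] comb by metis
qed

section \<open>Automorphisms\<close>

lemma G2D:
  assumes "g \<in> G2"
  shows G2_bij: "bij g"
    and G2_oadd: "g (oadd x y) = oadd (g x) (g y)"
    and G2_osmult: "g (osmult c x) = osmult c (g x)"
    and G2_omul: "g (omul x y) = omul (g x) (g y)"
  using assms by (auto simp: G2_def)

lemma G2I:
  assumes "\<And>x. h (g x) = x" "\<And>x. g (h x) = x"
    and "\<And>x y. g (oadd x y) = oadd (g x) (g y)"
    and "\<And>c x. g (osmult c x) = osmult c (g x)"
    and "\<And>x y. g (omul x y) = omul (g x) (g y)"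
  shows "g \<in> G2"
  using assms by (auto simp: G2_def intro!: bijI' dest: arg_cong[of _ _ h]) metis+

lemma G2_id: "(\<lambda>x. x) \<in> G2"
  by (rule G2I[of "\<lambda>x. x"]) auto

lemma G2_comp: "g \<in> G2 \<Longrightarrow> h \<in> G2 \<Longrightarrow> (\<lambda>x. g (h x)) \<in> G2"
  using bij_comp[of h g] by (auto simp: G2_def comp_def)

lemma G2_inv:
  assumes "g \<in> G2"
  shows "inv g \<in> G2"
proof (rule G2I[of g])
  show h: "g (inv g x) = x" "inv g (g x) = x" for x
    using G2_bij[OF assms] by (simp_all add: bij_is_inj bij_is_surj surj_f_inv_f)
  have eq: "inv g z = y" if "g y = z" for y z using that h by auto
  show "inv g (oadd x y) = oadd (inv g x) (inv g y)" for x y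
    by (rule eq) (simp add: G2_oadd[OF assms] h)
  show "inv g (osmult c x) = osmult c (inv g x)" for c x
    by (rule eq) (simp add: G2_osmult[OF assms] h)
  show "inv g (omul x y) = omul (inv g x) (inv g y)" for x y
    by (rule eq) (simp add: G2_omul[OF assms] h)
qed

lemma G2_inv_apply:
  assumes "g \<in> G2"
  shows "g (inv g x) = x" "inv g (g x) = x"
  using G2_bij[OF assms] by (simp_all add: bij_is_inj bij_is_surj surj_f_inv_f)

lemma G2_ozero: "g \<in> G2 \<Longrightarrow> g ozero = ozero"
  using G2_osmult[of g 0 ozero] by simp

lemma G2_oone:
  assumes "g \<in> G2"
  shows "g oone = oone"
proof -
  have "omul (g oone) y = y" for y
    using G2_omul[OF assms, of oone "inv g y"] by (simp add: G2_inv_apply[OF assms])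
  from this[of oone] show ?thesis by simp
qed

lemma osmult_oone_cancel: "osmult c oone = osmult d oone \<longleftrightarrow> c = d"
  by (auto simp: oone_def)

text \<open>Membership in \<open>G2\<close> only asks for an algebra automorphism. The image under g
  of x^2 = tr(x) x - n(x), compared with the same equation for g(x), gives (tr(g(x)) - tr(x)) g(x) =
  (n(g(x)) - n(x)) 1. If g(x) is not a scalar, both coefficients vanish; scalars are fixed by
  g.\<close>

lemma G2_trace_norm:
  fixes g :: "'a::field oct \<Rightarrow> 'a oct"
  assumes g: "g \<in> G2"
  shows G2_otr: "otr (g x) = otr x" and G2_onorm: "onorm (g x) = onorm x"
proof -
  have "otr (g x) = otr x \<and> onorm (g x) = onorm x"
  proof (cases "\<exists>c. g x = osmult c oone")
    case True
    then obtain c where c: "g x = osmult c oone" by blast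
    then have "g x = g (osmult c oone)" using G2_osmult[OF g] G2_oone[OF g] by simp
    then have "x = osmult c oone" using G2_bij[OF g] by (metis bij_pointE)
    with c show ?thesis by simp
  next
    case False
    have "g (omul x x) = oadd (osmult (otr x) (g x)) (osmult (- onorm x) oone)"
      unfolding omul_self[of x] by (simp add: G2_oadd[OF g] G2_osmult[OF g] G2_oone[OF g])
    moreover have "g (omul x x) = oadd (osmult (otr (g x)) (g x)) (osmult (- onorm (g x)) oone)"
      unfolding G2_omul[OF g] by (rule omul_self)
    ultimately have eq: "osmult (otr (g x) - otr x) (g x) = osmult (onorm (g x) - onorm x) oone"
      by (cases "g x") (simp add: oone_def algebra_simps)
    show ?thesis
    proof (cases "otr (g x) = otr x")
      case True
      then show ?thesis using eq osmult_oone_cancel[of 0 "onorm (g x) - onorm x"] by simp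
    next
      case neq: False
      have "g x = osmult (inverse (otr (g x) - otr x) * (onorm (g x) - onorm x)) oone"
        using arg_cong[OF eq, of "osmult (inverse (otr (g x) - otr x))"] neq by simp
      with False show ?thesis by blast
    qed
  qed
  then show "otr (g x) = otr x" "onorm (g x) = onorm x" by auto
qed

text \<open>For fixed w, the maps with parameter tw form a unipotent one-parameter group, a short
  root group of G2 when w is a unit vector. Unlike SL3 it moves diagonal matrices, and so it can
  normalise the diagonal.\<close>

definition shift :: "'a::comm_ring_1 \<Rightarrow> 'a \<Rightarrow> 'a \<Rightarrow> 'a oct \<Rightarrow> 'a oct" where
  "shift w1 w2 w3 x = (case x of Oct a u1 u2 u3 v1 v2 v3 b \<Rightarrow>
     let d = w1 * v1 + w2 * v2 + w3 * v3 in
     Oct (a - d) (u1 + (a - b - d) * w1) (u2 + (a - b - d) * w2) (u3 + (a - b - d) * w3)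
       (v1 + (w2 * u3 - w3 * u2)) (v2 + (w3 * u1 - w1 * u3)) (v3 + (w1 * u2 - w2 * u1)) (b + d))"

lemma shift_Oct [simp]:
  "shift w1 w2 w3 (Oct a u1 u2 u3 v1 v2 v3 b) =
     Oct (a - (w1 * v1 + w2 * v2 + w3 * v3))
       (u1 + (a - b - (w1 * v1 + w2 * v2 + w3 * v3)) * w1)
       (u2 + (a - b - (w1 * v1 + w2 * v2 + w3 * v3)) * w2)
       (u3 + (a - b - (w1 * v1 + w2 * v2 + w3 * v3)) * w3)
       (v1 + (w2 * u3 - w3 * u2)) (v2 + (w3 * u1 - w1 * u3)) (v3 + (w1 * u2 - w2 * u1))
       (b + (w1 * v1 + w2 * v2 + w3 * v3))"
  by (simp add: shift_def Let_def)

lemma shift_inverse: "shift (- w1) (- w2) (- w3) (shift w1 w2 w3 x) = x"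
  by (cases x) (simp add: algebra_simps)

lemma shift_G2: "shift w1 w2 w3 \<in> G2"
proof (rule G2I[of "shift (- w1) (- w2) (- w3)"])
  show "shift (- w1) (- w2) (- w3) (shift w1 w2 w3 x) = x" for x
    by (rule shift_inverse)
  show "shift w1 w2 w3 (shift (- w1) (- w2) (- w3) x) = x" for x
    using shift_inverse[of "- w1" "- w2" "- w3" x] by simp
  show "shift w1 w2 w3 (oadd x y) = oadd (shift w1 w2 w3 x) (shift w1 w2 w3 y)" for x y
    by (cases x; cases y; simp add: algebra_simps)
  show "shift w1 w2 w3 (osmult c x) = osmult c (shift w1 w2 w3 x)" for c x
    by (cases x; simp add: algebra_simps)
  show "shift w1 w2 w3 (omul x y) = omul (shift w1 w2 w3 x) (shift w1 w2 w3 y)" for x y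
    by (cases x; cases y; simp add: algebra_simps)
qed

definition oswap :: "'a::comm_ring_1 oct \<Rightarrow> 'a oct" where
  "oswap x = Oct (ob x) (- ov1 x) (- ov2 x) (- ov3 x) (- ou1 x) (- ou2 x) (- ou3 x) (oa x)"

lemma oswap_Oct [simp]:
  "oswap (Oct a u1 u2 u3 v1 v2 v3 b) = Oct b (- v1) (- v2) (- v3) (- u1) (- u2) (- u3) a"
  by (simp add: oswap_def)

lemma oswap_G2: "oswap \<in> G2"
proof (rule G2I[of oswap])
  show inv: "oswap (oswap x) = x" "oswap (oswap x) = x" for x :: "'a oct" by (cases x; simp)+
  show "oswap (oadd x y) = oadd (oswap x) (oswap y)" for x y :: "'a oct" by (cases x; cases y; simp)
  show "oswap (osmult c x) = osmult c (oswap x)" for c and x :: "'a oct" by (cases x; simp)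
  show "oswap (omul x y) = omul (oswap x) (oswap y)" for x y :: "'a oct"
    by (cases x; cases y; simp add: algebra_simps)
qed

text \<open>The matrix with columns x, y, z acts on the u-part, and its cofactor matrix, whose columns
  are y \<times> z, z \<times> x, x \<times> y, on the v-part.\<close>

definition osl3 ::
  "'a::comm_ring_1 \<times> 'a \<times> 'a \<Rightarrow> 'a \<times> 'a \<times> 'a \<Rightarrow> 'a \<times> 'a \<times> 'a \<Rightarrow> 'a oct \<Rightarrow> 'a oct" where
  "osl3 x y z p = mk_oct (oa p)
     (add3 (scal3 (ou1 p) x) (add3 (scal3 (ou2 p) y) (scal3 (ou3 p) z)))
     (add3 (scal3 (ov1 p) (cross3 y z)) (add3 (scal3 (ov2 p) (cross3 z x)) (scal3 (ov3 p) (cross3 x y))))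
     (ob p)"

lemma osl3_Oct [simp]:
  "osl3 (x1, x2, x3) (y1, y2, y3) (z1, z2, z3) (Oct a u1 u2 u3 v1 v2 v3 b) =
    Oct a (u1 * x1 + (u2 * y1 + u3 * z1)) (u1 * x2 + (u2 * y2 + u3 * z2)) (u1 * x3 + (u2 * y3 + u3 * z3))
      (v1 * (y2 * z3 - y3 * z2) + (v2 * (z2 * x3 - z3 * x2) + v3 * (x2 * y3 - x3 * y2)))
      (v1 * (y3 * z1 - y1 * z3) + (v2 * (z3 * x1 - z1 * x3) + v3 * (x3 * y1 - x1 * y3)))
      (v1 * (y1 * z2 - y2 * z1) + (v2 * (z1 * x2 - z2 * x1) + v3 * (x1 * y2 - x2 * y1))) b"
  by (simp add: osl3_def mk_oct_def cross3_def add3_def scal3_def)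

text \<open>A polynomial identity in the matrix entries, with the determinant d carried along as a
  factor; d = 1 enters only in \<open>osl3_G2\<close>. The same device is used in
  \<open>osl3_omul\<close>.\<close>

lemma osl3_cofactor:
  fixes x1 :: "'a::comm_ring_1"
  assumes "d = x1 * (y2 * z3 - y3 * z2) + x2 * (y3 * z1 - y1 * z3) + x3 * (y1 * z2 - y2 * z1)"
  shows "osl3 (y2 * z3 - y3 * z2, z2 * x3 - z3 * x2, x2 * y3 - x3 * y2)
      (y3 * z1 - y1 * z3, z3 * x1 - z1 * x3, x3 * y1 - x1 * y3)
      (y1 * z2 - y2 * z1, z1 * x2 - z2 * x1, x1 * y2 - x2 * y1)
      (osl3 (x1, x2, x3) (y1, y2, y3) (z1, z2, z3) (Oct a u1 u2 u3 v1 v2 v3 b)) =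
    Oct a (d * u1) (d * u2) (d * u3) (d\<^sup>2 * v1) (d\<^sup>2 * v2) (d\<^sup>2 * v3) b"
    and "osl3 (x1, x2, x3) (y1, y2, y3) (z1, z2, z3)
      (osl3 (y2 * z3 - y3 * z2, z2 * x3 - z3 * x2, x2 * y3 - x3 * y2)
      (y3 * z1 - y1 * z3, z3 * x1 - z1 * x3, x3 * y1 - x1 * y3)
      (y1 * z2 - y2 * z1, z1 * x2 - z2 * x1, x1 * y2 - x2 * y1) (Oct a u1 u2 u3 v1 v2 v3 b)) =
    Oct a (d * u1) (d * u2) (d * u3) (d\<^sup>2 * v1) (d\<^sup>2 * v2) (d\<^sup>2 * v3) b"
  by (simp_all add: assms power2_eq_square algebra_simps)

lemma osl3_omul:
  fixes x1 :: "'a::comm_ring_1"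
  assumes "d = x1 * (y2 * z3 - y3 * z2) + x2 * (y3 * z1 - y1 * z3) + x3 * (y1 * z2 - y2 * z1)"
  shows "omul (osl3 (x1, x2, x3) (y1, y2, y3) (z1, z2, z3) (Oct a u1 u2 u3 v1 v2 v3 b))
      (osl3 (x1, x2, x3) (y1, y2, y3) (z1, z2, z3) (Oct a' u1' u2' u3' v1' v2' v3' b')) =
    osl3 (x1, x2, x3) (y1, y2, y3) (z1, z2, z3) (Oct (a * a' + d * (u1 * v1' + u2 * v2' + u3 * v3'))
       (a * u1' + b' * u1 - d * (v2 * v3' - v3 * v2'))
       (a * u2' + b' * u2 - d * (v3 * v1' - v1 * v3'))
       (a * u3' + b' * u3 - d * (v1 * v2' - v2 * v1'))
       (a' * v1 + b * v1' + (u2 * u3' - u3 * u2'))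
       (a' * v2 + b * v2' + (u3 * u1' - u1 * u3'))
       (a' * v3 + b * v3' + (u1 * u2' - u2 * u1'))
       (b * b' + d * (v1 * u1' + v2 * u2' + v3 * u3')))"
  by (simp add: assms algebra_simps)

lemma osl3_G2:
  fixes x y z :: "'a::comm_ring_1 \<times> 'a \<times> 'a"
  assumes det: "dot3 x (cross3 y z) = 1"
  shows "osl3 x y z \<in> G2"
proof -
  obtain x1 x2 x3 where x: "x = (x1, x2, x3)" by (cases x) auto
  obtain y1 y2 y3 where y: "y = (y1, y2, y3)" by (cases y) auto
  obtain z1 z2 z3 where z: "z = (z1, z2, z3)" by (cases z) auto
  have D: "1 = x1 * (y2 * z3 - y3 * z2) + x2 * (y3 * z1 - y1 * z3) + x3 * (y1 * z2 - y2 * z1)"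
    using det by (simp add: x y z dot3_def cross3_def)
  let ?g = "osl3 (x1, x2, x3) (y1, y2, y3) (z1, z2, z3)"
  let ?h = "osl3 (y2 * z3 - y3 * z2, z2 * x3 - z3 * x2, x2 * y3 - x3 * y2)
    (y3 * z1 - y1 * z3, z3 * x1 - z1 * x3, x3 * y1 - x1 * y3)
    (y1 * z2 - y2 * z1, z1 * x2 - z2 * x1, x1 * y2 - x2 * y1)"
  show ?thesis unfolding x y z
  proof (rule G2I[of ?h])
    show "?h (?g p) = p" "?g (?h p) = p" for p
      by (cases p; simp only: osl3_cofactor[OF D] mult_1 power_one)+
    show "?g (oadd p q) = oadd (?g p) (?g q)" for p q
      by (cases p; cases q; simp add: algebra_simps)
    show "?g (osmult c p) = osmult c (?g p)" for c p
      by (cases p; simp add: algebra_simps)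
    show "?g (omul p q) = omul (?g p) (?g q)" for p q
      by (cases p; cases q; simp only: osl3_omul[OF D] omul_Oct mult_1)
  qed
qed

text \<open>For a matrix with columns p, y, z the first cofactor column is y x z. So it is enough to
  choose y and z in the plane orthogonal to q, scaled so that y x z = q; the determinant is then p .
  q = 1.\<close>

lemma G2_onto_dual_pair:
  fixes p1 :: "'a::field"
  assumes pq: "p1 * q1 + p2 * q2 + p3 * q3 = 1"
  obtains g where "g \<in> G2"
    and "\<And>a s t b. g (Oct a s 0 0 t 0 0 b) = Oct a (s * p1) (s * p2) (s * p3) (t * q1) (t * q2) (t * q3) b"
proof -
  have "\<exists>y1 y2 y3 z1 z2 z3. y2 * z3 - y3 * z2 = q1 \<and> y3 * z1 - y1 * z3 = q2 \<and> y1 * z2 - y2 * z1 = q3"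
  proof -
    consider "q1 \<noteq> 0" | "q2 \<noteq> 0" | "q3 \<noteq> 0" using pq by fastforce
    then show ?thesis
    proof cases
      case 1
      then show ?thesis
        by (intro exI[of _ "- q2"] exI[of _ q1] exI[of _ 0] exI[of _ "- q3 / q1"] exI[of _ 0] exI[of _ 1]) simp
    next
      case 2
      then show ?thesis
        by (intro exI[of _ 0] exI[of _ "- q3"] exI[of _ q2] exI[of _ 1] exI[of _ "- q1 / q2"] exI[of _ 0]) simp
    next
      case 3
      then show ?thesis
        by (intro exI[of _ q3] exI[of _ 0] exI[of _ "- q1"] exI[of _ 0] exI[of _ 1] exI[of _ "- q2 / q3"]) simp
    qed
  qed
  then obtain y1 y2 y3 z1 z2 z3 where
    yz: "y2 * z3 - y3 * z2 = q1" "y3 * z1 - y1 * z3 = q2" "y1 * z2 - y2 * z1 = q3" by blast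
  show thesis
  proof (rule that)
    show "osl3 (p1, p2, p3) (y1, y2, y3) (z1, z2, z3) \<in> G2"
      by (rule osl3_G2) (simp add: dot3_def cross3_def yz pq)
  qed (simp add: yz)
qed

section \<open>Normal forms of null vectors and of idempotents under G2\<close>

lemma exists_dual_vector:
  fixes v1 :: "'a::field"
  assumes "v1 \<noteq> 0 \<or> v2 \<noteq> 0 \<or> v3 \<noteq> 0"
  obtains w1 w2 w3 where "v1 * w1 + v2 * w2 + v3 * w3 = c"
proof -
  consider "v1 \<noteq> 0" | "v2 \<noteq> 0" | "v3 \<noteq> 0" using assms by blast
  then show thesis
    by cases (use that[of "c / v1" 0 0] that[of 0 "c / v2" 0] that[of 0 0 "c / v3"] in auto)
qed

text \<open>A shift clears the diagonal, the swap makes the u-part nonzero if necessary, a second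
  shift clears the v-part, and SL3 moves the u-part to the first unit vector.\<close>

lemma G2_null_to_U1:
  fixes x :: "'a::field oct"
  assumes "x \<noteq> ozero" "otr x = 0" "onorm x = 0"
  obtains g where "g \<in> G2" "g x = Oct 0 1 0 0 0 0 0 0"
proof -
  have offdiag: "\<exists>g \<in> G2. g x = Oct 0 1 0 0 0 0 0 0"
    if x: "x = Oct 0 u1 u2 u3 v1 v2 v3 0" and nz: "u1 \<noteq> 0 \<or> u2 \<noteq> 0 \<or> u3 \<noteq> 0" and n: "onorm x = 0"
    for x :: "'a oct" and u1 u2 u3 v1 v2 v3
  proof -
    obtain q1 q2 q3 where q: "u1 * q1 + u2 * q2 + u3 * q3 = 1"
      using nz by (rule exists_dual_vector)
    have uv: "u1 * v1 + u2 * v2 + u3 * v3 = 0"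
      using n unfolding x onorm_Oct by (metis diff_0 mult_zero_left neg_equal_0_iff_equal)
    \<comment> \<open>The parameter is w = v x q, where u . q = 1. Then w x u = (u . v) q - (u . q)
      v = -v, and w . v = 0 leaves the zero diagonal and u unchanged.\<close>
    let ?h = "shift (v2 * q3 - v3 * q2) (v3 * q1 - v1 * q3) (v1 * q2 - v2 * q1)"
    have *: "q1 * (u1 * v1 + u2 * v2 + u3 * v3) = 0" "q2 * (u1 * v1 + u2 * v2 + u3 * v3) = 0"
      "q3 * (u1 * v1 + u2 * v2 + u3 * v3) = 0" by (simp_all add: uv)
    have **: "v1 * (u1 * q1 + u2 * q2 + u3 * q3) = v1" "v2 * (u1 * q1 + u2 * q2 + u3 * q3) = v2"
      "v3 * (u1 * q1 + u2 * q2 + u3 * q3) = v3" by (simp_all add: q)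
    have h: "?h x = Oct 0 u1 u2 u3 0 0 0 0"
    proof -
      have v: "v1 + ((v3 * q1 - v1 * q3) * u3 - (v1 * q2 - v2 * q1) * u2) = 0"
        "v2 + ((v1 * q2 - v2 * q1) * u1 - (v2 * q3 - v3 * q2) * u3) = 0"
        "v3 + ((v2 * q3 - v3 * q2) * u2 - (v3 * q1 - v1 * q3) * u1) = 0"
        using * ** by algebra+
      have d: "(v2 * q3 - v3 * q2) * v1 + (v3 * q1 - v1 * q3) * v2 + (v1 * q2 - v2 * q1) * v3 = 0"
        by algebra
      show ?thesis unfolding x shift_Oct v d by simp
    qed
    obtain g where g: "g \<in> G2"
      "\<And>a s t b. g (Oct a s 0 0 t 0 0 b) = Oct a (s * u1) (s * u2) (s * u3) (t * q1) (t * q2) (t * q3) b"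
      using q by (rule G2_onto_dual_pair) (rule that)
    have "inv g (?h x) = Oct 0 1 0 0 0 0 0 0"
      using G2_inv_apply(2)[OF g(1), of "Oct 0 1 0 0 0 0 0 0"] by (simp add: g(2) h)
    then show ?thesis
      using G2_comp[OF G2_inv[OF g(1)] shift_G2] by (intro bexI[of _ "\<lambda>x. inv g (?h x)"])
  qed
  have offdiag': "\<exists>g \<in> G2. g x = Oct 0 1 0 0 0 0 0 0"
    if x: "x = Oct 0 u1 u2 u3 v1 v2 v3 0" and nz: "x \<noteq> ozero" and n: "onorm x = 0"
    for x :: "'a oct" and u1 u2 u3 v1 v2 v3
  proof (cases "u1 \<noteq> 0 \<or> u2 \<noteq> 0 \<or> u3 \<noteq> 0")
    case True
    then show ?thesis using offdiag[OF x _ n] by blast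
  next
    case False
    then have "- v1 \<noteq> 0 \<or> - v2 \<noteq> 0 \<or> - v3 \<noteq> 0" using nz by (auto simp: x ozero_def)
    then obtain g where "g \<in> G2" "g (oswap x) = Oct 0 1 0 0 0 0 0 0"
      using offdiag[of "oswap x" "- v1" "- v2" "- v3" "- u1" "- u2" "- u3"] n
      by (auto simp: x algebra_simps)
    then show ?thesis using G2_comp[OF _ oswap_G2] by (intro bexI[of _ "\<lambda>x. g (oswap x)"])
  qed
  obtain a u1 u2 u3 v1 v2 v3 b where x: "x = Oct a u1 u2 u3 v1 v2 v3 b" by (cases x)
  have b: "b = - a" using assms(2) by (simp add: x eq_neg_iff_add_eq_0 add.commute)
  have "\<exists>g \<in> G2. g x = Oct 0 1 0 0 0 0 0 0"
  proof (cases "v1 \<noteq> 0 \<or> v2 \<noteq> 0 \<or> v3 \<noteq> 0")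
    case True
    \<comment> \<open>With w . v = a the shift turns the diagonal (a, -a) into (0, 0). If instead v
      = 0, the norm -a^2 forces a = 0.\<close>
    then obtain w1 w2 w3 where w: "v1 * w1 + v2 * w2 + v3 * w3 = a" by (rule exists_dual_vector)
    let ?h = "shift w1 w2 w3"
    have w': "w1 * v1 + w2 * v2 + w3 * v3 = a" using w by (simp add: mult.commute)
    have "\<exists>g \<in> G2. g (?h x) = Oct 0 1 0 0 0 0 0 0"
    proof (rule offdiag')
      show "?h x = Oct 0 (u1 + (a - b - a) * w1) (u2 + (a - b - a) * w2) (u3 + (a - b - a) * w3)
       (v1 + (w2 * u3 - w3 * u2)) (v2 + (w3 * u1 - w1 * u3)) (v3 + (w1 * u2 - w2 * u1)) 0"
        by (simp only: x shift_Oct w') (simp add: b)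
      show "?h x \<noteq> ozero" using assms(1) G2_inv_apply(2)[OF shift_G2] G2_ozero[OF G2_inv[OF shift_G2]]
        by metis
      show "onorm (?h x) = 0" using assms(3) by (simp add: G2_onorm[OF shift_G2])
    qed
    then obtain g where "g \<in> G2" "g (?h x) = Oct 0 1 0 0 0 0 0 0" by blast
    then show ?thesis using G2_comp[OF _ shift_G2] by (intro bexI[of _ "\<lambda>x. g (?h x)"])
  next
    case False
    then have "a = 0" using assms(3) by (simp add: x b)
    then show ?thesis using offdiag'[OF _ assms(1,3)] by (simp add: x b)
  qed
  then show thesis using that by blast
qed

text \<open>Trace 1 and norm 0 mean that e is an idempotent other than 0 and 1. Once the diagonal is
  (1, 0), the shift by -u clears u, and the shift by -v, conjugated by the swap, clears v.\<close>

lemma G2_idempotent_to_E: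
  fixes e :: "'a::field oct"
  assumes "otr e = 1" "onorm e = 0"
  obtains g where "g \<in> G2" "g e = Oct 1 0 0 0 0 0 0 0"
proof -
  have one: "\<exists>g \<in> G2. g e = Oct 1 0 0 0 0 0 0 0"
    if e: "e = Oct 1 u1 u2 u3 v1 v2 v3 0" and n: "onorm e = 0" for e :: "'a oct" and u1 u2 u3 v1 v2 v3
  proof -
    let ?h = "shift (- u1) (- u2) (- u3)" and ?k = "shift (- v1) (- v2) (- v3)"
    have uv: "- u1 * v1 + - u2 * v2 + - u3 * v3 = 0"
      using n by (simp add: e algebra_simps)
    have "?h e = Oct 1 0 0 0 v1 v2 v3 0"
      unfolding e shift_Oct uv by (simp add: mult.commute)
    then have "oswap (?k (oswap (?h e))) = Oct 1 0 0 0 0 0 0 0"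
      by (simp add: mult.commute)
    moreover have "(\<lambda>x. oswap (?k (oswap (?h x)))) \<in> G2"
      by (intro G2_comp[OF oswap_G2] G2_comp[OF shift_G2] G2_comp[OF oswap_G2 shift_G2])
    ultimately show ?thesis by (rule bexI)
  qed
  obtain a u1 u2 u3 v1 v2 v3 b where e: "e = Oct a u1 u2 u3 v1 v2 v3 b" by (cases e)
  have b: "b = 1 - a" using assms(1) by (simp add: e eq_diff_eq add.commute)
  have "\<exists>h \<in> G2. \<exists>u1 u2 u3 v1 v2 v3. h e = Oct 1 u1 u2 u3 v1 v2 v3 0"
  proof (cases "v1 \<noteq> 0 \<or> v2 \<noteq> 0 \<or> v3 \<noteq> 0")
    case True
    \<comment> \<open>With w . v = a - 1 the shift turns the diagonal (a, 1 - a) into (1, 0). If v =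
      0, the norm a(1 - a) leaves only a = 1 and a = 0, and the swap handles the latter.\<close>
    then obtain w1 w2 w3 where w: "v1 * w1 + v2 * w2 + v3 * w3 = a - 1" by (rule exists_dual_vector)
    have w': "w1 * v1 + w2 * v2 + w3 * v3 = a - 1" using w by (simp add: mult.commute)
    show ?thesis
      by (rule bexI[OF _ shift_G2[of w1 w2 w3]]) (simp only: e shift_Oct w', simp add: b)
  next
    case False
    then have "a = 0 \<or> a = 1" using assms(2) by (simp add: e b)
    then show ?thesis
    proof
      assume "a = 1"
      then show ?thesis using G2_id by (intro bexI[of _ "\<lambda>x. x"]) (auto simp: e b)
    next
      assume "a = 0"
      then show ?thesis by (intro bexI[OF _ oswap_G2]) (auto simp: e b)
    qed
  qed
  then obtain h u1 u2 u3 v1 v2 v3 where h: "h \<in> G2" "h e = Oct 1 u1 u2 u3 v1 v2 v3 0" by blast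
  obtain g where "g \<in> G2" "g (h e) = Oct 1 0 0 0 0 0 0 0"
    using one[OF h(2)] assms(2) by (auto simp: G2_onorm[OF h(1)])
  then show thesis using G2_comp[OF _ h(1)] by (intro that[of "\<lambda>x. g (h x)"])
qed

section \<open>Traces of left-normed products\<close>

definition rmuls :: "(nat \<Rightarrow> 'a::comm_ring_1 oct) \<Rightarrow> 'a oct \<Rightarrow> nat list \<Rightarrow> 'a oct" where
  "rmuls a x w = foldl (\<lambda>x i. omul x (a i)) x w"

lemma rmuls_simps [simp]:
  "rmuls a x [] = x" "rmuls a x (i # w) = rmuls a (omul x (a i)) w"
  "rmuls a x (w @ w') = rmuls a (rmuls a x w) w'"
  by (simp_all add: rmuls_def)

lemma rmuls_linear [simp]:
  "rmuls a (oadd x y) w = oadd (rmuls a x w) (rmuls a y w)"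
  "rmuls a (osmult c x) w = osmult c (rmuls a x w)"
  by (induction w arbitrary: x y) simp_all

lemma lnprod_eq_rmuls: "w \<noteq> [] \<Longrightarrow> lnprod a w = rmuls a oone w"
  by (cases w) (simp_all add: lnprod_def rmuls_def)

lemma omul_osym:
  "omul x (osym y z) =
    oadd (oadd (osmult (otr y) (omul x z)) (osmult (otr z) (omul x y))) (osmult (- opolar y z) x)"
  by (simp add: osym_def)

text \<open>By the linearised right alternative law (xy)z + (xz)y = x(yz + zy), and yz + zy is a
  combination of y, z and 1. The correction terms are therefore words with one or two letters
  fewer.\<close>

lemma otr_rmuls_swap:
  "otr (rmuls a x (i # j # w)) + otr (rmuls a x (j # i # w)) =
    otr (a i) * otr (rmuls a x (j # w)) + otr (a j) * otr (rmuls a x (i # w))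
      - opolar (a i) (a j) * otr (rmuls a x w)"
proof -
  have "otr (rmuls a x (i # j # w)) + otr (rmuls a x (j # i # w)) =
      otr (rmuls a (omul x (osym (a i) (a j))) w)"
    by (simp flip: omul_right_alternative_linear)
  then show ?thesis by (simp only: omul_osym rmuls_linear otr_simps rmuls_simps) simp
qed

lemma otr_rmuls_repeat:
  "otr (rmuls a x (i # i # w)) =
    otr (a i) * otr (rmuls a x (i # w)) - onorm (a i) * otr (rmuls a x w)"
  by (simp add: omul_right_alternative omul_self[of "a i"])

text \<open>Adjacent transpositions suffice: the first entry of ys is moved to the front of xs step
  by step, and the prefix p absorbs the entries already in place.\<close>

lemma perm_invariant_if_swap_invariant:
  assumes swap: "\<And>p i j q. P (p @ i # j # q) \<Longrightarrow> P (p @ j # i # q)"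
    and "mset xs = mset ys" "P xs"
  shows "P ys"
proof -
  have front: "P (p @ y # a @ b)" if "P (p @ a @ y # b)" for p a b y
    using that
  proof (induction a arbitrary: b rule: rev_induct)
    case (snoc z a)
    then show ?case using swap[of "p @ a" z y b] by simp
  qed simp
  have "P (p @ ys)" if "mset xs = mset ys" "P (p @ xs)" for p
    using that
  proof (induction ys arbitrary: xs p)
    case (Cons y ys)
    then obtain a b where xs: "xs = a @ y # b"
      by (metis list.set_intros(1) mset_eq_setD split_list)
    show ?case
      using Cons.IH[of "a @ b" "p @ [y]"] Cons.prems front[of p a y b] by (simp add: xs)
  qed simp
  from this[of "[]"] assms show ?thesis by simp
qed

section \<open>Agreement of traces on words of bounded length\<close>

definition traces_agree ::
  "nat \<Rightarrow> nat \<Rightarrow> (nat \<Rightarrow> 'a::comm_ring_1 oct) \<Rightarrow> (nat \<Rightarrow> 'a oct) \<Rightarrow> bool" where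
  "traces_agree n k u v \<longleftrightarrow>
    (\<forall>w. set w \<subseteq> {..<n} \<and> length w \<le> k \<longrightarrow> otr (rmuls u oone w) = otr (rmuls v oone w))"

lemma traces_agreeD:
  "traces_agree n k u v \<Longrightarrow> set w \<subseteq> {..<n} \<Longrightarrow> length w \<le> k \<Longrightarrow>
    otr (rmuls u oone w) = otr (rmuls v oone w)"
  by (simp add: traces_agree_def)

lemma traces_agree_mono: "traces_agree n k u v \<Longrightarrow> l \<le> k \<Longrightarrow> traces_agree n l u v"
  by (simp add: traces_agree_def)

lemma traces_agree_swap:
  assumes H: "traces_agree n k u v" and w: "set (p @ i # j # q) \<subseteq> {..<n}" "length (p @ i # j # q) = Suc k"
    and eq: "otr (rmuls u oone (p @ i # j # q)) = otr (rmuls v oone (p @ i # j # q))"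
  shows "otr (rmuls u oone (p @ j # i # q)) = otr (rmuls v oone (p @ j # i # q))"
\<comment> \<open>The polar form of two letters involves a word of length 2, on which agreement is
  known only for k \<ge> 2. Otherwise the word consists of i and j alone, and tr(xy) = tr(yx)
  settles it.\<close>
proof (cases "k \<ge> 2")
  case True
  have tr: "otr (u i) = otr (v i)" "otr (u j) = otr (v j)"
    using traces_agreeD[OF H, of "[i]"] traces_agreeD[OF H, of "[j]"] w by auto
  have pol: "opolar (u i) (u j) = opolar (v i) (v j)"
    using traces_agreeD[OF H, of "[i, j]"] w True tr by (auto simp: opolar_def)
  have low: "otr (rmuls u oone (p @ j # q)) = otr (rmuls v oone (p @ j # q))"
    "otr (rmuls u oone (p @ i # q)) = otr (rmuls v oone (p @ i # q))"
    "otr (rmuls u oone (p @ q)) = otr (rmuls v oone (p @ q))"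
    by (rule traces_agreeD[OF H]; use w in auto)+
  have "otr (rmuls a oone (p @ j # i # q)) = - otr (rmuls a oone (p @ i # j # q)) +
      otr (a i) * otr (rmuls a oone (p @ j # q)) + otr (a j) * otr (rmuls a oone (p @ i # q))
        - opolar (a i) (a j) * otr (rmuls a oone (p @ q))" for a :: "nat \<Rightarrow> 'a oct"
    using otr_rmuls_swap[of a "rmuls a oone p" i j q] by (simp add: algebra_simps)
  then show ?thesis by (simp only: eq tr pol low)
next
  case False
  then have "length p + length q = 0" using w(2) unfolding length_append list.size by linarith
  then have "p = []" "q = []" by auto
  then show ?thesis using eq by (simp add: otr_commute)
qed

lemma traces_agree_perm:
  assumes "traces_agree n k u v" and "set w \<subseteq> {..<n}" "length w = Suc k" "mset w = mset w'"
    and "otr (rmuls u oone w) = otr (rmuls v oone w)"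
  shows "otr (rmuls u oone w') = otr (rmuls v oone w')"
proof -
  let ?P = "\<lambda>w. set w \<subseteq> {..<n} \<and> length w = Suc k \<and> otr (rmuls u oone w) = otr (rmuls v oone w)"
  have "?P w'"
    by (rule perm_invariant_if_swap_invariant[of ?P w])
      (use assms traces_agree_swap[OF assms(1)] in auto)
  then show ?thesis by simp
qed

text \<open>A permutation brings the repeated letter y to the front twice; then y^2 = tr(y) y - n(y)
  reduces the trace to shorter words.\<close>

lemma traces_agree_not_distinct:
  assumes H: "traces_agree n k u v" and N: "\<And>i. i < n \<Longrightarrow> onorm (u i) = onorm (v i)"
    and w: "set w \<subseteq> {..<n}" "length w = Suc k" "\<not> distinct w"
  shows "otr (rmuls u oone w) = otr (rmuls v oone w)"
proof -
  obtain xs ys zs y where d: "w = xs @ [y] @ ys @ [y] @ zs"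
    using not_distinct_decomp[OF w(3)] by blast
  let ?q = "xs @ ys @ zs"
  show ?thesis
  proof (rule traces_agree_perm[OF H])
    show "set (y # y # ?q) \<subseteq> {..<n}" "length (y # y # ?q) = Suc k" "mset (y # y # ?q) = mset w"
      using w by (auto simp: d)
    have tr: "otr (u y) = otr (v y)"
      using traces_agreeD[OF H, of "[y]"] w by (auto simp: d)
    have low: "otr (rmuls u oone (y # ?q)) = otr (rmuls v oone (y # ?q))"
      "otr (rmuls u oone ?q) = otr (rmuls v oone ?q)"
      by (rule traces_agreeD[OF H]; use w in \<open>auto simp: d\<close>)+
    have "onorm (u y) = onorm (v y)" using N w by (simp add: d)
    then show "otr (rmuls u oone (y # y # ?q)) = otr (rmuls v oone (y # y # ?q))"
      by (simp only: otr_rmuls_repeat tr low)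
  qed
qed

lemma traces_agree_if_sorted:
  assumes N: "\<And>i. i < n \<Longrightarrow> onorm (u i) = onorm (v i)"
    and S: "\<And>w. w \<noteq> [] \<Longrightarrow> length w \<le> K \<Longrightarrow> sorted_wrt (<) w \<Longrightarrow> set w \<subseteq> {..<n} \<Longrightarrow>
      otr (rmuls u oone w) = otr (rmuls v oone w)"
  shows "k \<le> K \<Longrightarrow> traces_agree n k u v"
proof (induction k)
  case 0
  then show ?case by (simp add: traces_agree_def)
next
  case (Suc k)
  then have H: "traces_agree n k u v" by simp
  have "otr (rmuls u oone w) = otr (rmuls v oone w)" if w: "set w \<subseteq> {..<n}" "length w = Suc k" for w
  proof (cases "distinct w")
    case True
    show ?thesis
    proof (rule traces_agree_perm[OF H])
      show "otr (rmuls u oone (sort w)) = otr (rmuls v oone (sort w))"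
        using w Suc.prems True by (intro S) (auto simp: strict_sorted_iff simp flip: length_0_conv)
    qed (use w in auto)
  qed (rule traces_agree_not_distinct[OF H N w])
  then show ?case using H by (auto simp: traces_agree_def le_Suc_eq)
qed

text \<open>The pairs (p(u), p(v)) for one and the same combination p of left-normed words of length
  at most k. This is the graph of p(u) \<mapsto> p(v), stated as a relation because it is not yet
  known to be well defined.\<close>

inductive lncomb :: "nat \<Rightarrow> (nat \<Rightarrow> 'a::comm_ring_1 oct) \<Rightarrow> (nat \<Rightarrow> 'a oct) \<Rightarrow>
    nat \<Rightarrow> 'a oct \<Rightarrow> 'a oct \<Rightarrow> bool" for n u v where
  one: "lncomb n u v 0 oone oone"
| step: "lncomb n u v k x y \<Longrightarrow> i < n \<Longrightarrow> lncomb n u v (Suc k) (omul x (u i)) (omul y (v i))"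
| add: "lncomb n u v k x y \<Longrightarrow> lncomb n u v k x' y' \<Longrightarrow> lncomb n u v k (oadd x x') (oadd y y')"
| smult: "lncomb n u v k x y \<Longrightarrow> lncomb n u v k (osmult c x) (osmult c y)"
| mono: "lncomb n u v k x y \<Longrightarrow> lncomb n u v (Suc k) x y"

lemma lncomb_le: "lncomb n u v k x y \<Longrightarrow> k \<le> l \<Longrightarrow> lncomb n u v l x y"
  by (induction l) (auto simp: le_Suc_eq intro: lncomb.mono)

lemma lncomb_add_max:
  "lncomb n u v k x y \<Longrightarrow> lncomb n u v l x' y' \<Longrightarrow> lncomb n u v (max k l) (oadd x x') (oadd y y')"
  by (meson lncomb.add lncomb_le max.cobounded1 max.cobounded2)

lemma lncomb_fst: "lncomb n u v k x y \<Longrightarrow> lncomb n u u k x x"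
  by (induction rule: lncomb.induct) (auto intro: lncomb.intros)

lemma lncomb_snd: "lncomb n u v k x y \<Longrightarrow> lncomb n v v k y y"
  by (induction rule: lncomb.induct) (auto intro: lncomb.intros)

lemma lncomb_change_snd: "lncomb n u v k x y \<Longrightarrow> \<exists>z. lncomb n u v' k x z"
  by (induction rule: lncomb.induct) (auto intro: lncomb.intros)

lemma lncomb_change_fst: "lncomb n u v k x y \<Longrightarrow> \<exists>z. lncomb n u' v k z y"
  by (induction rule: lncomb.induct) (auto intro: lncomb.intros)

lemma lncomb_diagonal: "lncomb n u u k x y \<Longrightarrow> x = y"
  by (induction rule: lncomb.induct) auto

lemma lncomb_letter: "i < n \<Longrightarrow> lncomb n u v (Suc 0) (u i) (v i)"
  using lncomb.step[OF lncomb.one, of i n u v] by simp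

lemma lncomb_otr_rmuls:
  assumes "traces_agree n K u v"
  shows "lncomb n u v k x y \<Longrightarrow> set w \<subseteq> {..<n} \<Longrightarrow> k + length w \<le> K \<Longrightarrow>
    otr (rmuls u x w) = otr (rmuls v y w)"
proof (induction arbitrary: w rule: lncomb.induct)
  case one
  then show ?case using assms by (simp add: traces_agreeD)
next
  case (step k x y i)
  then show ?case using step.IH[of "i # w"] by simp
qed auto

lemma lncomb_otr: "traces_agree n K u v \<Longrightarrow> lncomb n u v k x y \<Longrightarrow> k \<le> K \<Longrightarrow> otr x = otr y"
  using lncomb_otr_rmuls[of n K u v k x y "[]"] by simp

text \<open>Since tr(x(za)) = tr((ax)z) and ax = (xa + ax) - xa, the last letter a of the right
  factor moves to the left factor, up to traces of smaller products. Repeating this exhausts the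
  right factor while the total degree stays the same.\<close>

lemma otr_omul_omul:
  "otr (omul x (omul z a)) = otr x * otr (omul z a) + otr a * otr (omul x z)
    - opolar x a * otr z - otr (omul (omul x a) z)"
proof -
  have "otr (omul x (omul z a)) = otr (omul (omul a x) z)"
    by (metis otr_assoc otr_commute)
  moreover have "otr (omul (omul x a) z) + otr (omul (omul a x) z) = otr (omul (osym x a) z)"
    by (simp flip: omul_anticommute)
  ultimately show ?thesis by (simp add: osym_def otr_commute[of a z] algebra_simps)
qed

lemma lncomb_otr_omul:
  assumes H: "traces_agree n K u v"
  shows "lncomb n u v l x' y' \<Longrightarrow> lncomb n u v k x y \<Longrightarrow> k + l \<le> K \<Longrightarrow>
    otr (omul x x') = otr (omul y y')"
proof (induction arbitrary: k x y rule: lncomb.induct)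
  case one
  then show ?case using lncomb_otr[OF H, of k x y] by simp
next
  case (step l z z' i)
  have "otr x = otr y" "otr z = otr z'" "otr (u i) = otr (v i)"
    "otr (omul z (u i)) = otr (omul z' (v i))" "otr (omul x (u i)) = otr (omul y (v i))"
    using step.prems by (auto intro!: lncomb_otr[OF H] lncomb.step step.hyps lncomb_letter)
  moreover have "otr (omul x z) = otr (omul y z')" using step by auto
  moreover have "otr (omul (omul x (u i)) z) = otr (omul (omul y (v i)) z')"
    using step.prems by (intro step.IH[OF lncomb.step] step.hyps) auto
  ultimately show ?case unfolding otr_omul_omul opolar_def by simp
next
  case (mono l x' y')
  then show ?case by auto
qed auto

lemma lncomb_opolar:
  assumes H: "traces_agree n K u v" and xy: "lncomb n u v k x y" "lncomb n u v l x' y'" and "k + l \<le> K"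
  shows "opolar x x' = opolar y y'"
proof -
  have "otr x = otr y" "otr x' = otr y'" "otr (omul x x') = otr (omul y y')"
    using lncomb_otr[OF H xy(1)] lncomb_otr[OF H xy(2)] lncomb_otr_omul[OF H xy(2,1)] assms(4) by auto
  then show ?thesis by (simp add: opolar_def)
qed

text \<open>The norm is multiplicative on products with letters. A sum brings in the polar form of
  two elements of degree k, whence the bound \<open>2 * k \<le> K\<close>.\<close>

lemma lncomb_onorm:
  assumes H: "traces_agree n K u v" and N: "\<And>i. i < n \<Longrightarrow> onorm (u i) = onorm (v i)"
  shows "lncomb n u v k x y \<Longrightarrow> 2 * k \<le> K \<Longrightarrow> onorm x = onorm y"
proof (induction rule: lncomb.induct)
  case (add k x y x' y')
  then show ?case using lncomb_opolar[OF H add.hyps] by (simp add: onorm_oadd)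
qed (auto simp: onorm_omul N)

text \<open>Induction on the right factor with \<open>omul_reassociate\<close>. The coefficients
  occurring in \<open>osym\<close> are traces and polar forms; they have to be equal at u and v for
  both sides to be the same combination, which is why agreement in all degrees is assumed.\<close>

lemma lncomb_omul:
  assumes H: "\<And>K. traces_agree n K u v"
  shows "lncomb n u v l x' y' \<Longrightarrow> lncomb n u v k x y \<Longrightarrow> \<exists>m. lncomb n u v m (omul x x') (omul y y')"
proof (induction arbitrary: k x y rule: lncomb.induct)
  case one
  then show ?case by auto
next
  case (step l z z' i)
  \<comment> \<open>R forgets the degrees, so the reassociated product can be assembled by closure
    rules alone.\<close>
  define R where "R = (\<lambda>x y. \<exists>k. lncomb n u v k x y)"
  have one: "R oone oone" unfolding R_def by (blast intro: lncomb.one)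
  have st: "R (omul x (u i)) (omul y (v i))" if "R x y" for x y
    using that step.hyps unfolding R_def by (blast intro: lncomb.step)
  have add: "R (oadd x x') (oadd y y')" if R: "R x y" "R x' y'" for x y x' y'
  proof -
    obtain k l where "lncomb n u v k x y" "lncomb n u v l x' y'" using R unfolding R_def by blast
    then show ?thesis unfolding R_def by (blast intro: lncomb_add_max)
  qed
  have sm: "R (osmult c x) (osmult c y)" if "R x y" for x y c
    using that unfolding R_def by (blast intro: lncomb.smult)
  have tr: "otr x = otr y" if "R x y" for x y
    using that lncomb_otr[OF H] unfolding R_def by blast
  have po: "opolar x x' = opolar y y'" if "R x y" "R x' y'" for x y x' y'
    using that lncomb_opolar[OF H] unfolding R_def by blast
  have sy: "R (osym x x') (osym y y')" if "R x y" "R x' y'" for x y x' y'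
    unfolding osym_def po[OF that] tr[OF that(1)] tr[OF that(2)] by (intro add sm one that)
  have xy: "R x y" and zz: "R z z'" and uv: "R (u i) (v i)" and xz: "R (omul x z) (omul y z')"
    using step.prems step.hyps step.IH lncomb_letter unfolding R_def by blast+
  have "R (omul x (osym z (u i))) (omul y (osym z' (v i)))"
    unfolding omul_osym po[OF zz uv] tr[OF zz] tr[OF uv] by (intro add sm st xy xz)
  then have "R (omul x (omul z (u i))) (omul y (omul z' (v i)))"
    unfolding omul_reassociate[of x z "u i"] omul_reassociate[of y z' "v i"]
    by (intro add sm sy st xy xz zz)
  then show ?case unfolding R_def .
next
  case (add l x' y' x'' y'')
  obtain p q where "lncomb n u v p (omul x x') (omul y y')" "lncomb n u v q (omul x x'') (omul y y'')"
    using add by blast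
  from lncomb_add_max[OF this] show ?case by auto
next
  case (smult l x' y' c)
  then obtain m where "lncomb n u v m (omul x x') (omul y y')" by blast
  from lncomb.smult[OF this, of c] show ?case by auto
qed auto

section \<open>Trace degrees above eight\<close>

lemma homogeneous_system_nontrivial:
  fixes f :: "'b \<Rightarrow> nat \<Rightarrow> 'a::field"
  assumes "finite J" "card J > m"
  shows "\<exists>c. (\<exists>j\<in>J. c j \<noteq> 0) \<and> (\<forall>i<m. (\<Sum>j\<in>J. c j * f j i) = 0)"
  using assms
proof (induction m arbitrary: J f)
  case 0
  then obtain j where "j \<in> J" by fastforce
  then show ?case by (intro exI[of _ "\<lambda>_. 1"]) auto
next
  case (Suc m)
  show ?case
  proof (cases "\<forall>j\<in>J. f j m = 0")
    case True
    obtain c where "\<exists>j\<in>J. c j \<noteq> 0" "\<forall>i<m. (\<Sum>j\<in>J. c j * f j i) = 0"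
      using Suc.IH[of J f] Suc.prems by auto
    with True show ?thesis by (intro exI[of _ c]) (auto simp: less_Suc_eq)
  next
    case False
    then obtain p where p: "p \<in> J" "f p m \<noteq> 0" by blast
    \<comment> \<open>Gaussian elimination: equation m is solved for the unknown p, which is then
      eliminated from the other equations.\<close>
    let ?J = "J - {p}" and ?f = "\<lambda>j i. f j i - f j m / f p m * f p i"
    obtain c where c: "\<exists>j\<in>?J. c j \<noteq> 0" "\<forall>i<m. (\<Sum>j\<in>?J. c j * ?f j i) = 0"
    proof -
      have "finite ?J" "m < card ?J" using Suc.prems p by auto
      from Suc.IH[OF this, of ?f] show thesis using that by blast
    qed
    let ?d = "c(p := - (\<Sum>j\<in>?J. c j * f j m) / f p m)"
    have split: "(\<Sum>j\<in>J. ?d j * f j i) = (\<Sum>j\<in>?J. c j * ?f j i)" for i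
    proof -
      have "(\<Sum>j\<in>J. ?d j * f j i) = ?d p * f p i + (\<Sum>j\<in>?J. ?d j * f j i)"
        using p(1) Suc.prems(1) by (simp only: sum.remove)
      also have "(\<Sum>j\<in>?J. ?d j * f j i) = (\<Sum>j\<in>?J. c j * f j i)"
        by (intro sum.cong) auto
      also have "?d p * f p i = - (\<Sum>j\<in>?J. c j * f j m / f p m * f p i)"
        by (simp add: sum_divide_distrib sum_distrib_right)
      finally show ?thesis
        by (simp add: right_diff_distrib sum_subtractf mult.assoc)
    qed
    have "(\<Sum>j\<in>J. ?d j * f j i) = 0" if "i < Suc m" for i
      using that c(2) p(2) by (cases "i = m") (simp_all only: split, auto)
    then show ?thesis using c(1) by (intro exI[of _ ?d]) auto
  qed
qed

lemma ocoord_simps [simp]: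
  "ocoord 0 (Oct a u1 u2 u3 v1 v2 v3 b) = a" "ocoord 1 (Oct a u1 u2 u3 v1 v2 v3 b) = u1"
  "ocoord 2 (Oct a u1 u2 u3 v1 v2 v3 b) = u2" "ocoord 3 (Oct a u1 u2 u3 v1 v2 v3 b) = u3"
  "ocoord 4 (Oct a u1 u2 u3 v1 v2 v3 b) = v1" "ocoord 5 (Oct a u1 u2 u3 v1 v2 v3 b) = v2"
  "ocoord 6 (Oct a u1 u2 u3 v1 v2 v3 b) = v3" "ocoord 7 (Oct a u1 u2 u3 v1 v2 v3 b) = b"
  by (simp_all add: ocoord_def)

lemma less_8_cases:
  assumes "i < (8::nat)"
  obtains "i = 0" | "i = 1" | "i = 2" | "i = 3" | "i = 4" | "i = 5" | "i = 6" | "i = 7"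
  using assms by linarith

lemma oct_eqI:
  assumes "\<And>i. i < 8 \<Longrightarrow> ocoord i x = ocoord i y"
  shows "x = y"
proof -
  have "ocoord 0 x = ocoord 0 y" "ocoord 1 x = ocoord 1 y" "ocoord 2 x = ocoord 2 y"
    "ocoord 3 x = ocoord 3 y" "ocoord 4 x = ocoord 4 y" "ocoord 5 x = ocoord 5 y"
    "ocoord 6 x = ocoord 6 y" "ocoord 7 x = ocoord 7 y"
    by (rule assms; simp)+
  then show ?thesis by (cases x; cases y) (simp only: ocoord_simps)
qed

lemma ocoord_linear:
  assumes "i < 8"
  shows "ocoord i (oadd x y) = ocoord i x + ocoord i y" "ocoord i (osmult c x) = c * ocoord i x"
    "ocoord i ozero = 0"
  using assms
  by (cases rule: less_8_cases; cases x; cases y; simp only: oadd_Oct osmult_Oct ozero_def ocoord_simps)+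

primrec olin :: "(nat \<Rightarrow> 'a::comm_ring_1) \<Rightarrow> (nat \<Rightarrow> 'a oct) \<Rightarrow> nat \<Rightarrow> 'a oct" where
  "olin c x 0 = ozero"
| "olin c x (Suc m) = oadd (olin c x m) (osmult (c m) (x m))"

lemma ocoord_olin: "i < 8 \<Longrightarrow> ocoord i (olin c x m) = (\<Sum>j<m. c j * ocoord i (x j))"
  by (induction m) (auto simp: ocoord_linear)

lemma otr_omul_olin: "otr (omul z (olin c x m)) = (\<Sum>j<m. c j * otr (omul z (x j)))"
  by (induction m) auto

lemma nine_octs_dependent:
  fixes x :: "nat \<Rightarrow> 'a::field oct"
  obtains c where "\<exists>j<9. c j \<noteq> 0" "olin c x 9 = ozero"
proof -
  obtain c where c: "\<exists>j\<in>{..<9}. c j \<noteq> 0" "\<forall>i<8. (\<Sum>j<9. c j * ocoord i (x j)) = 0"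
    using homogeneous_system_nontrivial[of "{..<9::nat}" 8 "\<lambda>j i. ocoord i (x j)"] by auto
  show thesis
    by (rule that[of c]) (use c in \<open>auto intro!: oct_eqI simp: ocoord_olin ocoord_linear\<close>)
qed

lemma olin_zero_tail: "m \<le> l \<Longrightarrow> (\<And>j. m \<le> j \<Longrightarrow> j < l \<Longrightarrow> c j = 0) \<Longrightarrow> olin c x l = olin c x m"
  by (induction l) (auto simp: le_Suc_eq)

text \<open>\<open>V 0\<close> already contains 1, so eight strict inclusions, one for each k \<le>
  7, would produce nine independent octonions.\<close>

lemma subspace_chain_stabilises:
  fixes V :: "nat \<Rightarrow> 'a::field oct set"
  assumes one: "oone \<in> V 0"
    and add: "\<And>k x y. x \<in> V k \<Longrightarrow> y \<in> V k \<Longrightarrow> oadd x y \<in> V k"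
    and smult: "\<And>k c x. x \<in> V k \<Longrightarrow> osmult c x \<in> V k"
    and mono: "\<And>k. V k \<subseteq> V (Suc k)"
  shows "\<exists>k\<le>7. V (Suc k) = V k"
proof (rule ccontr)
  assume contr: "\<not> (\<exists>k\<le>7. V (Suc k) = V k)"
  have "\<exists>x. x \<in> V (Suc k) \<and> x \<notin> V k" if "k \<le> 7" for k
  proof -
    have "V (Suc k) \<noteq> V k" using contr \<open>k \<le> 7\<close> that by blast
    then show ?thesis using mono[of k] by blast
  qed
  then obtain y where y: "\<And>k. k \<le> 7 \<Longrightarrow> y k \<in> V (Suc k) \<and> y k \<notin> V k" by metis
  \<comment> \<open>The element with index k lies in \<open>V k\<close>, and for k > 0 it lies
    outside \<open>V (k - 1)\<close>.\<close>
  define x where "x = (\<lambda>k. case k of 0 \<Rightarrow> oone | Suc k \<Rightarrow> y k)"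
  have x: "x k \<in> V k" if "k < 9" for k using that y one by (cases k) (auto simp: x_def)
  have V: "V k \<subseteq> V l" if "k \<le> l" for k l using that mono by (rule lift_Suc_mono_le[rotated])
  obtain c where c: "\<exists>j<9. c j \<noteq> 0" "olin c x 9 = ozero" by (rule nine_octs_dependent)
  \<comment> \<open>For the largest index j with a nonzero coefficient, x j is a combination of its
    predecessors. If j = 0 this says 1 = 0; otherwise it puts x j into
    \<open>V (j - 1)\<close>.\<close>
  define j where "j = Max {j. j < 9 \<and> c j \<noteq> 0}"
  have "j \<in> {j. j < 9 \<and> c j \<noteq> 0}" unfolding j_def by (rule Max_in) (use c(1) in auto)
  then have j: "j < 9" "c j \<noteq> 0" by auto
  have tail: "c i = 0" if "Suc j \<le> i" "i < 9" for i
  proof (rule ccontr)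
    assume "c i \<noteq> 0"
    then have "i \<le> j" unfolding j_def using that by (intro Max_ge) auto
    then show False using that by simp
  qed
  have z: "olin c x (Suc j) = ozero" using olin_zero_tail[of "Suc j" 9 c x] tail j c(2) by auto
  have xj: "x j = osmult (- inverse (c j)) (olin c x j)"
  proof -
    have "x j = osmult (inverse (c j)) (osmult (c j) (x j))" using j by simp
    also have "osmult (c j) (x j) = osmult (-1) (olin c x j)"
      using z by (cases "olin c x j"; cases "x j") (simp add: ozero_def eq_neg_iff_add_eq_0 add.commute)
    finally show ?thesis by simp
  qed
  show False
  proof (cases j)
    case 0
    then show ?thesis using xj j by (simp add: x_def oone_def ozero_def)
  next
    case (Suc i)
    have "olin c x m \<in> V i" if "m \<le> j" for m
      using that
    proof (induction m)
      case 0
      then show ?case using smult[OF one, of 0] V[of 0 i] by auto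
    next
      case (Suc m)
      then show ?case using \<open>j = Suc i\<close> j x[of m] V[of m i] by (auto intro!: add smult)
    qed
    then have "x j \<in> V i" unfolding xj by (intro smult) simp
    then show ?thesis using y[of i] Suc j by (simp add: x_def)
  qed
qed

text \<open>The span of all left-normed words in the letters; by \<open>gen_omul\<close> it is the
  unital algebra generated by them.\<close>

definition gen :: "nat \<Rightarrow> (nat \<Rightarrow> 'a::comm_ring_1 oct) \<Rightarrow> 'a oct set" where
  "gen n u = {x. \<exists>k. lncomb n u u k x x}"

text \<open>Once two successive degrees have the same span, that span is stable under right
  multiplication by letters and contains all words.\<close>

lemma gen_eq_degree_7:
  fixes u :: "nat \<Rightarrow> 'a::field oct"
  shows "gen n u = {x. lncomb n u u 7 x x}"
proof -
  define V where "V = (\<lambda>k. {x. lncomb n u u k x x})"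
  have "\<exists>k\<le>7. V (Suc k) = V k"
    by (rule subspace_chain_stabilises) (auto simp: V_def intro: lncomb.intros)
  then obtain k where k: "k \<le> 7" "V (Suc k) = V k" by blast
  have "lncomb n u u m x y \<Longrightarrow> lncomb n u u k x y" for m x y
  proof (induction rule: lncomb.induct)
    case (step m x y i)
    then have "lncomb n u u (Suc k) (omul x (u i)) (omul y (u i))" by (intro lncomb.step)
    then show ?case using k(2) lncomb_diagonal by (fastforce simp: V_def)
  qed (auto intro: lncomb.intros lncomb_le[OF lncomb.one])
  from this[THEN lncomb_le[OF _ k(1)]] show ?thesis by (auto simp: gen_def)
qed

text \<open>If B contains 1, orthogonality to B for tr(xy) is the same as for the polar form, so
  this is nondegeneracy of the quadratic form n on B. The condition on the norm matters in
  characteristic 2, where tr(1) = 0 and 1 itself can be orthogonal to B.\<close>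

definition nondegenerate :: "'a::comm_ring_1 oct set \<Rightarrow> bool" where
  "nondegenerate B \<longleftrightarrow>
    (\<forall>x\<in>B. onorm x = 0 \<longrightarrow> (\<forall>y\<in>B. otr (omul x y) = 0) \<longrightarrow> x = ozero)"

lemma traces_agree_all:
  fixes u v :: "nat \<Rightarrow> 'a::field oct"
  assumes H8: "traces_agree n 8 u v" and N: "\<And>i. i < n \<Longrightarrow> onorm (u i) = onorm (v i)"
    and nd: "nondegenerate (gen n v)"
  shows "traces_agree n K u v"
proof (induction K)
  case 0
  then show ?case using traces_agree_mono[OF H8] by simp
next
  case (Suc k)
  \<comment> \<open>A relation between 1 and the letters that holds at u also holds at v: its value
    y at v has norm 0, and tr(yz) = 0 for every z of degree 7, hence for all z in the algebra. The
    bound 8 is the sum of the degrees 1 and 7.\<close>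
  have zero: "y = ozero" if y: "lncomb n u v 1 ozero y" for y
  proof -
    have "onorm y = 0" using lncomb_onorm[OF H8 N y] by simp
    moreover have "y \<in> gen n v" using lncomb_snd[OF y] by (auto simp: gen_def)
    moreover have "otr (omul y z) = 0" if z: "z \<in> gen n v" for z
    proof -
      have "lncomb n v v 7 z z" using z by (simp add: gen_eq_degree_7)
      from lncomb_change_fst[OF this, of u] obtain z' where "lncomb n u v 7 z' z" ..
      then show ?thesis using lncomb_otr_omul[OF H8 _ y, of 7 z' z] by simp
    qed
    ultimately show ?thesis using nd unfolding nondegenerate_def by blast
  qed
  have "otr (rmuls u oone w) = otr (rmuls v oone w)"
    if w: "set w \<subseteq> {..<n}" "length w = Suc k" and "Suc k > 8" for w
  proof -
    \<comment> \<open>The nine octonions are 1 and the first eight letters of w.\<close>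
    define X where "X = (\<lambda>(a :: nat \<Rightarrow> 'a oct) j. case j of 0 \<Rightarrow> oone | Suc i \<Rightarrow> a (w ! i))"
    have wi: "w ! i \<in> set w" "w ! i < n" if "i < 8" for i
      using that w \<open>Suc k > 8\<close> by (auto simp: subset_iff)
    obtain c where c: "\<exists>j<9. c j \<noteq> 0" "olin c (X u) 9 = ozero" by (rule nine_octs_dependent)
    have lin: "lncomb n u v 1 (olin c (X u) m) (olin c (X v) m)" if "m \<le> 9" for m
      using that
    proof (induction m)
      case 0
      show ?case using lncomb.smult[OF lncomb_le[OF lncomb.one, of 1 n u v], of 0] by simp
    next
      case (Suc m)
      have "lncomb n u v 1 (X u m) (X v m)"
        using Suc.prems wi lncomb_letter[of "w ! (m - 1)" n u v] lncomb_le[OF lncomb.one, of 1 n u v]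
        by (cases m) (auto simp: X_def)
      then show ?case using Suc by (auto intro!: lncomb.add lncomb.smult)
    qed
    have c': "olin c (X v) 9 = ozero" using lin[of 9] c(2) zero by simp
    \<comment> \<open>A relation with only a constant term would say 1 = 0. So some letter is a
      combination of 1 and the other letters, with the same coefficients at u and at v.\<close>
    have "\<exists>i<8. c (Suc i) \<noteq> 0"
    proof (rule ccontr)
      assume "\<not> ?thesis"
      then have tail: "c j = 0" if "1 \<le> j" "j < 9" for j using that by (cases j) auto
      then have "olin c (X u) 9 = osmult (c 0) oone"
        using olin_zero_tail[of 1 9 c "X u"] by (simp add: X_def)
      then have "c 0 = 0" using c(2) by (simp add: oone_def ozero_def)
      then show False using c(1) tail by (metis less_one not_le)
    qed
    then obtain i where i: "i < 8" "c (Suc i) \<noteq> 0" by blast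
    \<comment> \<open>The letter with index i is moved to the end of the word, where the relation
      can be substituted for it.\<close>
    let ?p = "take i w @ drop (Suc i) w"
    have iw: "i < length w" using i(1) w(2) \<open>Suc k > 8\<close> by simp
    have wsplit: "w = take i w @ w ! i # drop (Suc i) w" using iw by (rule id_take_nth_drop)
    have mw: "mset (?p @ [w ! i]) = mset w" using arg_cong[OF wsplit, of mset] by simp
    have pw: "set ?p \<subseteq> set w" using set_take_subset[of i w] set_drop_subset[of "Suc i" w] by simp
    then have pn: "set ?p \<subseteq> {..<n}" using w(1) by blast
    have lp: "length ?p = k" using iw w(2) by simp
    \<comment> \<open>Replacing the last letter by 1 shortens the word; replacing it by another of
      the eight letters repeats a letter of \<open>?p\<close>.\<close>
    have terms: "otr (omul (rmuls u oone ?p) (X u j)) = otr (omul (rmuls v oone ?p) (X v j))"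
      if j: "j < 9" "j \<noteq> Suc i" for j
    proof (cases j)
      case 0
      then show ?thesis using traces_agreeD[OF Suc.IH pn] lp by (simp add: X_def)
    next
      case (Suc l)
      have lw: "l < length w" "l \<noteq> i" using j Suc w(2) \<open>Suc k > 8\<close> by auto
      have "w ! l \<in> set ?p"
      proof (cases "l < i")
        case True
        then have "w ! l = take i w ! l" "l < length (take i w)" using lw by auto
        then have "w ! l \<in> set (take i w)" by (metis nth_mem)
        then show ?thesis by simp
      next
        case False
        then have "w ! l = drop (Suc i) w ! (l - Suc i)" "l - Suc i < length (drop (Suc i) w)"
          using lw by auto
        then have "w ! l \<in> set (drop (Suc i) w)" by (metis nth_mem)
        then show ?thesis by simp
      qed
      then have "\<not> distinct (?p @ [w ! l])" unfolding distinct_append[of ?p] by simp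
      moreover have "set (?p @ [w ! l]) \<subseteq> {..<n}" "length (?p @ [w ! l]) = Suc k"
        using pn lp nth_mem[OF lw(1)] w(1) by auto
      ultimately have "otr (rmuls u oone (?p @ [w ! l])) = otr (rmuls v oone (?p @ [w ! l]))"
        by (intro traces_agree_not_distinct[OF Suc.IH N])
      then show ?thesis by (simp add: Suc X_def)
    qed
    have sum: "c (Suc i) * otr (omul (rmuls a oone ?p) (X a (Suc i))) =
        - (\<Sum>j\<in>{..<9} - {Suc i}. c j * otr (omul (rmuls a oone ?p) (X a j)))"
      if "olin c (X a) 9 = ozero" for a
    proof -
      have "(\<Sum>j<9. c j * otr (omul (rmuls a oone ?p) (X a j))) = 0"
        using otr_omul_olin[of "rmuls a oone ?p" c "X a" 9] that by simp
      then show ?thesis using i(1) sum.remove[of "{..<9}" "Suc i"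
          "\<lambda>j. c j * otr (omul (rmuls a oone ?p) (X a j))"]
        by (simp add: eq_neg_iff_add_eq_0)
    qed
    have "(\<Sum>j\<in>{..<9} - {Suc i}. c j * otr (omul (rmuls u oone ?p) (X u j))) =
        (\<Sum>j\<in>{..<9} - {Suc i}. c j * otr (omul (rmuls v oone ?p) (X v j)))"
      by (intro sum.cong) (use terms in auto)
    then have "otr (omul (rmuls u oone ?p) (X u (Suc i))) = otr (omul (rmuls v oone ?p) (X v (Suc i)))"
      using sum[OF c(2)] sum[OF c'] i(2) by (metis mult_left_cancel)
    then have "otr (rmuls u oone (?p @ [w ! i])) = otr (rmuls v oone (?p @ [w ! i]))"
      by (simp add: X_def)
    then show ?thesis
      using pn lp nth_mem[OF iw] w(1) by (intro traces_agree_perm[OF Suc.IH _ _ mw]) auto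
  qed
  then have "otr (rmuls u oone w) = otr (rmuls v oone w)" if "set w \<subseteq> {..<n}" "length w \<le> Suc k" for w
    using that traces_agreeD[OF H8, of w] traces_agreeD[OF Suc.IH, of w]
    by (cases "length w \<le> k \<or> length w \<le> 8") auto
  then show ?case by (simp add: traces_agree_def)
qed

section \<open>Extending isometries to automorphisms\<close>

abbreviation E11 :: "'a::comm_ring_1 oct" where "E11 \<equiv> Oct 1 0 0 0 0 0 0 0"
abbreviation U1 :: "'a::comm_ring_1 oct" where "U1 \<equiv> Oct 0 1 0 0 0 0 0 0"
abbreviation V1 :: "'a::comm_ring_1 oct" where "V1 \<equiv> Oct 0 0 0 0 1 0 0 0"

text \<open>In the plane of the second and third u-coordinates, X and V1 Y have determinant 1 up to
  sign because p . q = 1; the same holds for Y and U1 X in the v-coordinates. Solving these two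
  systems yields the missing unit vectors.\<close>

lemma subalgebra_eq_UNIV:
  fixes B :: "'a::comm_ring_1 oct set"
  assumes one: "oone \<in> B"
    and add: "\<And>x y. x \<in> B \<Longrightarrow> y \<in> B \<Longrightarrow> oadd x y \<in> B"
    and smult: "\<And>c x. x \<in> B \<Longrightarrow> osmult c x \<in> B"
    and mul: "\<And>x y. x \<in> B \<Longrightarrow> y \<in> B \<Longrightarrow> omul x y \<in> B"
    and gens: "E11 \<in> B" "U1 \<in> B" "V1 \<in> B" "Oct 0 0 p2 p3 0 0 0 0 \<in> B" "Oct 0 0 0 0 0 q2 q3 0 \<in> B"
    and pq: "p2 * q2 + p3 * q3 = 1"
  shows "B = UNIV"
proof -
  let ?X = "Oct 0 0 p2 p3 0 0 0 0" and ?Y = "Oct 0 0 0 0 0 q2 q3 0"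
  have qp: "p3 * q3 + p2 * q2 = 1" "q2 * p2 + q3 * p3 = 1" "q3 * p3 + q2 * p2 = 1"
    using pq by (simp_all add: algebra_simps)
  have "oadd (osmult q2 ?X) (osmult p3 (omul V1 ?Y)) \<in> B"
    "oadd (osmult q3 ?X) (osmult (- p2) (omul V1 ?Y)) \<in> B"
    "oadd (osmult p2 ?Y) (osmult (- q3) (omul U1 ?X)) \<in> B"
    "oadd (osmult p3 ?Y) (osmult q2 (omul U1 ?X)) \<in> B"
    "oadd oone (osmult (-1) E11) \<in> B"
    by (intro add smult mul gens one)+
  then have b: "Oct 0 0 1 0 0 0 0 0 \<in> B" "Oct 0 0 0 1 0 0 0 0 \<in> B" "Oct 0 0 0 0 0 1 0 0 \<in> B"
    "Oct 0 0 0 0 0 0 1 0 \<in> B" "Oct 0 0 0 0 0 0 0 1 \<in> B"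
    using pq qp by (simp_all add: oone_def mult.commute)
  have "x \<in> B" for x
  proof -
    obtain a u1 u2 u3 v1 v2 v3 d where x: "x = Oct a u1 u2 u3 v1 v2 v3 d" by (cases x)
    have "x = oadd (osmult a E11) (oadd (osmult u1 U1) (oadd (osmult u2 (Oct 0 0 1 0 0 0 0 0))
      (oadd (osmult u3 (Oct 0 0 0 1 0 0 0 0)) (oadd (osmult v1 V1) (oadd (osmult v2 (Oct 0 0 0 0 0 1 0 0))
      (oadd (osmult v3 (Oct 0 0 0 0 0 0 1 0)) (osmult d (Oct 0 0 0 0 0 0 0 1))))))))"
      by (simp add: x)
    then show ?thesis using gens b by (simp only: add smult)
  qed
  then show ?thesis by blast
qed

text \<open>R is a relation between two subalgebras. That it is the graph of an isomorphism follows
  from nondegeneracy: a partner of 0 has norm 0 and is orthogonal to everything, see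
  \<open>fst_ozero\<close> and \<open>functional\<close>.\<close>

locale oct_isometry =
  fixes R :: "('a::field oct \<times> 'a oct) set"
  assumes one: "(oone, oone) \<in> R"
    and add: "(x, y) \<in> R \<Longrightarrow> (x', y') \<in> R \<Longrightarrow> (oadd x x', oadd y y') \<in> R"
    and smult: "(x, y) \<in> R \<Longrightarrow> (osmult c x, osmult c y) \<in> R"
    and mul: "(x, y) \<in> R \<Longrightarrow> (x', y') \<in> R \<Longrightarrow> (omul x x', omul y y') \<in> R"
    and trace: "(x, y) \<in> R \<Longrightarrow> otr x = otr y"
    and norm: "(x, y) \<in> R \<Longrightarrow> onorm x = onorm y"
    and nondeg_fst: "nondegenerate (fst ` R)"
    and nondeg_snd: "nondegenerate (snd ` R)"
begin

lemma converse: "oct_isometry (R\<inverse>)"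
proof
  have "fst ` (R\<inverse>) = snd ` R" "snd ` (R\<inverse>) = fst ` R" by force+
  then show "nondegenerate (fst ` (R\<inverse>))" "nondegenerate (snd ` (R\<inverse>))"
    using nondeg_fst nondeg_snd by simp_all
qed (use one add smult mul trace norm in auto)

lemma fst_ozero: "(ozero, y) \<in> R \<Longrightarrow> y = ozero"
proof -
  assume y: "(ozero, y) \<in> R"
  have "otr (omul y z) = 0" if "(z', z) \<in> R" for z z'
    using trace[OF mul[OF y that]] by simp
  then show ?thesis
    using nondeg_snd y norm[OF y] unfolding nondegenerate_def by force
qed

lemma functional: "(x, y) \<in> R \<Longrightarrow> (x, z) \<in> R \<Longrightarrow> y = z"
  using fst_ozero[of "oadd y (osmult (-1) z)"] add[of x y "osmult (-1) x" "osmult (-1) z"] smult[of x z "-1"]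
  by (simp add: oadd_osmult_neg iffD2[OF oadd_osmult_neg])

lemma dual_element:
  assumes "(x, y) \<in> R" "x \<noteq> ozero" "onorm x = 0"
  obtains z z' where "(z, z') \<in> R" "otr (omul x z) = 1"
proof -
  obtain w w' where w: "(w, w') \<in> R" "otr (omul x w) \<noteq> 0"
    using nondeg_fst assms unfolding nondegenerate_def by force
  show thesis
    by (rule that[OF smult[OF w(1), of "inverse (otr (omul x w))"]]) (use w in simp)
qed

text \<open>Source and target can be brought into standard position by different automorphisms;
  \<open>G2_extends_transport\<close> undoes this.\<close>

lemma transport:
  assumes g: "g \<in> G2" and h: "h \<in> G2"
  shows "oct_isometry (map_prod g h ` R)"
proof
  have img: "(g a, h b) \<in> map_prod g h ` R" if "(a, b) \<in> R" for a b
    using imageI[OF that, of "map_prod g h"] by simp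
  have pre: "\<exists>a b. x = g a \<and> y = h b \<and> (a, b) \<in> R" if "(x, y) \<in> map_prod g h ` R" for x y
    using that by auto
  show "(oone, oone) \<in> map_prod g h ` R"
    using img[OF one] by (simp add: G2_oone[OF g] G2_oone[OF h])
  fix x y x' y' assume xy: "(x, y) \<in> map_prod g h ` R"
  obtain a b where ab: "x = g a" "y = h b" "(a, b) \<in> R" using pre[OF xy] by blast
  show "(osmult c x, osmult c y) \<in> map_prod g h ` R" for c
    using img[OF smult[OF ab(3)]] by (simp add: ab G2_osmult[OF g] G2_osmult[OF h])
  show "otr x = otr y" "onorm x = onorm y"
    using trace[OF ab(3)] norm[OF ab(3)]
    by (simp_all add: ab G2_otr[OF g] G2_otr[OF h] G2_onorm[OF g] G2_onorm[OF h])
  assume xy': "(x', y') \<in> map_prod g h ` R"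
  obtain a' b' where ab': "x' = g a'" "y' = h b'" "(a', b') \<in> R" using pre[OF xy'] by blast
  show "(oadd x x', oadd y y') \<in> map_prod g h ` R"
    using img[OF add[OF ab(3) ab'(3)]] by (simp add: ab ab' G2_oadd[OF g] G2_oadd[OF h])
  show "(omul x x', omul y y') \<in> map_prod g h ` R"
    using img[OF mul[OF ab(3) ab'(3)]] by (simp add: ab ab' G2_omul[OF g] G2_omul[OF h])
next
  have nd: "nondegenerate (k ` B)" if "nondegenerate B" "k \<in> G2" for k and B :: "'a oct set"
    using that(1) unfolding nondegenerate_def
    by (auto simp: G2_onorm[OF that(2)] G2_omul[OF that(2), symmetric] G2_otr[OF that(2)] G2_ozero[OF that(2)])
  have "fst ` map_prod g h ` R = g ` fst ` R" "snd ` map_prod g h ` R = h ` snd ` R" by force+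
  then show "nondegenerate (fst ` map_prod g h ` R)" "nondegenerate (snd ` map_prod g h ` R)"
    using nd[OF nondeg_fst g] nd[OF nondeg_snd h] by simp_all
qed

end

definition G2_extends :: "('a::comm_ring_1 oct \<times> 'a oct) set \<Rightarrow> bool" where
  "G2_extends R \<longleftrightarrow> (\<exists>g\<in>G2. \<forall>(x, y)\<in>R. y = g x)"

lemma G2_extends_transport:
  assumes g: "g \<in> G2" and h: "h \<in> G2" and "G2_extends (map_prod g h ` R)"
  shows "G2_extends R"
proof -
  obtain k where k: "k \<in> G2" "\<forall>(x, y)\<in>map_prod g h ` R. y = k x"
    using assms(3) unfolding G2_extends_def by blast
  have "y = inv h (k (g x))" if "(x, y) \<in> R" for x y
    using k(2) that G2_inv_apply(2)[OF h, of y] by force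
  then show ?thesis
    unfolding G2_extends_def
    using G2_comp[OF G2_inv[OF h] G2_comp[OF k(1) g]] by (intro bexI[of _ "\<lambda>x. inv h (k (g x))"]) auto
qed

context oct_isometry
begin

lemma G2_extends_if_total:
  assumes "\<And>x. \<exists>y. (x, y) \<in> R" "\<And>y. \<exists>x. (x, y) \<in> R"
  shows "G2_extends R"
proof -
  obtain g h where g: "\<And>x. (x, g x) \<in> R" and h: "\<And>y. (h y, y) \<in> R"
    using assms by metis
  interpret conv: oct_isometry "R\<inverse>" by (rule converse)
  have "g \<in> G2"
  proof (rule G2I)
    show "h (g x) = x" for x using conv.functional[of "g x" "h (g x)" x] g h by simp
    show "g (h x) = x" for x using functional[OF g h] .
    show "g (oadd x y) = oadd (g x) (g y)" for x y using functional[OF g add[OF g g]] .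
    show "g (osmult c x) = osmult c (g x)" for c x using functional[OF g smult[OF g]] .
    show "g (omul x y) = omul (g x) (g y)" for x y using functional[OF g mul[OF g g]] .
  qed
  then show ?thesis using functional[OF _ g] unfolding G2_extends_def by blast
qed

lemma G2_extends_id: "(\<And>x y. (x, y) \<in> R \<Longrightarrow> (x, x) \<in> R) \<Longrightarrow> G2_extends R"
  unfolding G2_extends_def using functional by (intro bexI[OF _ G2_id]) auto

text \<open>The Peirce decomposition for the idempotent \<open>E11\<close>: ex - (ex)e and xe -
  (ex)e are the u-part and the v-part of x.\<close>

lemma peirce:
  assumes E: "(E11, E11) \<in> R" and xy: "(x, y) \<in> R"
  shows "(Oct 0 (ou1 x) (ou2 x) (ou3 x) 0 0 0 0, Oct 0 (ou1 y) (ou2 y) (ou3 y) 0 0 0 0) \<in> R"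
    and "(Oct 0 0 0 0 (ov1 x) (ov2 x) (ov3 x) 0, Oct 0 0 0 0 (ov1 y) (ov2 y) (ov3 y) 0) \<in> R"
proof -
  have "(oadd (omul E11 x) (osmult (-1) (omul (omul E11 x) E11)),
      oadd (omul E11 y) (osmult (-1) (omul (omul E11 y) E11))) \<in> R"
    "(oadd (omul x E11) (osmult (-1) (omul (omul E11 x) E11)),
      oadd (omul y E11) (osmult (-1) (omul (omul E11 y) E11))) \<in> R"
    by (intro add smult mul E xy)+
  then show "(Oct 0 (ou1 x) (ou2 x) (ou3 x) 0 0 0 0, Oct 0 (ou1 y) (ou2 y) (ou3 y) 0 0 0 0) \<in> R"
    "(Oct 0 0 0 0 (ov1 x) (ov2 x) (ov3 x) 0, Oct 0 0 0 0 (ov1 y) (ov2 y) (ov3 y) 0) \<in> R"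
    by (cases x; cases y; simp)+
qed

lemma diagonal_in: "(E11, E11) \<in> R \<Longrightarrow> (Oct a 0 0 0 0 0 0 b, Oct a 0 0 0 0 0 0 b) \<in> R"
  using add[OF smult[of E11 E11 "a - b"] smult[OF one, of b]] by (simp add: oone_def)

text \<open>If source elements involve only \<open>E11\<close>, 1, \<open>U1\<close> and
  \<open>V1\<close>, then R is part of the identity. Otherwise a further off-diagonal element and
  its dual lie in R, and on both sides they generate all octonions together with these, so R is
  total.\<close>

lemma G2_extends_if_M2:
  assumes E: "(E11, E11) \<in> R" and U: "(U1, U1) \<in> R" and V: "(V1, V1) \<in> R"
  shows "G2_extends R"
proof (cases "\<forall>(x, y) \<in> R. ou2 x = 0 \<and> ou3 x = 0 \<and> ov2 x = 0 \<and> ov3 x = 0")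
  case True
  show ?thesis
  proof (rule G2_extends_id)
    fix x y assume "(x, y) \<in> R"
    then have "x = oadd (Oct (oa x) 0 0 0 0 0 0 (ob x)) (oadd (osmult (ou1 x) U1) (osmult (ov1 x) V1))"
      using True by (cases x) auto
    then show "(x, x) \<in> R" using add[OF diagonal_in[OF E] add[OF smult[OF U] smult[OF V]]] by metis
  qed
next
  case False
  have X: "(Oct 0 0 (ou2 x) (ou3 x) 0 0 0 0, Oct 0 0 (ou2 y) (ou3 y) 0 0 0 0) \<in> R"
    and Y: "(Oct 0 0 0 0 0 (ov2 x) (ov3 x) 0, Oct 0 0 0 0 0 (ov2 y) (ov3 y) 0) \<in> R"
    if xy: "(x, y) \<in> R" for x y
  proof -
    \<comment> \<open>The first off-diagonal coordinates are traces of products with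
      \<open>V1\<close> and \<open>U1\<close>. Hence R preserves them, and multiples of
      \<open>U1\<close> and \<open>V1\<close> can be subtracted.\<close>
    have "ou1 x = ou1 y" using trace[OF mul[OF V peirce(1)[OF E xy]]] by simp
    then show "(Oct 0 0 (ou2 x) (ou3 x) 0 0 0 0, Oct 0 0 (ou2 y) (ou3 y) 0 0 0 0) \<in> R"
      using add[OF peirce(1)[OF E xy] smult[OF U, of "- ou1 x"]] by simp
    have "ov1 x = ov1 y" using trace[OF mul[OF U peirce(2)[OF E xy]]] by simp
    then show "(Oct 0 0 0 0 0 (ov2 x) (ov3 x) 0, Oct 0 0 0 0 0 (ov2 y) (ov3 y) 0) \<in> R"
      using add[OF peirce(2)[OF E xy] smult[OF V, of "- ov1 x"]] by simp
  qed
  obtain x y where xy: "(x, y) \<in> R" and "ou2 x \<noteq> 0 \<or> ou3 x \<noteq> 0 \<or> ov2 x \<noteq> 0 \<or> ov3 x \<noteq> 0"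
    using False by auto
  then consider (u) "ou2 x \<noteq> 0 \<or> ou3 x \<noteq> 0" | (v) "ov2 x \<noteq> 0 \<or> ov3 x \<noteq> 0" by blast
  then obtain p2 p3 p2' p3' q2 q3 q2' q3' where
    p: "(Oct 0 0 p2 p3 0 0 0 0, Oct 0 0 p2' p3' 0 0 0 0) \<in> R" and
    q: "(Oct 0 0 0 0 0 q2 q3 0, Oct 0 0 0 0 0 q2' q3' 0) \<in> R" and
    pq: "p2 * q2 + p3 * q3 = 1"
  proof cases
    case u
    obtain z z' where z: "(z, z') \<in> R" "otr (omul (Oct 0 0 (ou2 x) (ou3 x) 0 0 0 0) z) = 1"
      by (rule dual_element[OF X[OF xy]]) (use u in \<open>auto simp: ozero_def\<close>)
    then have "ou2 x * ov2 z + ou3 x * ov3 z = 1" by (cases z) simp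
    then show thesis by (rule that[OF X[OF xy] Y[OF z(1)]])
  next
    case v
    obtain z z' where z: "(z, z') \<in> R" "otr (omul (Oct 0 0 0 0 0 (ov2 x) (ov3 x) 0) z) = 1"
      by (rule dual_element[OF Y[OF xy]]) (use v in \<open>auto simp: ozero_def\<close>)
    then have "ou2 z * ov2 x + ou3 z * ov3 x = 1" by (cases z) (simp add: mult.commute)
    then show thesis by (rule that[OF X[OF z(1)] Y[OF xy]])
  qed
  have pq': "p2' * q2' + p3' * q3' = 1" using trace[OF mul[OF p q]] pq by simp
  show ?thesis
  proof (rule G2_extends_if_total)
    have "{x. \<exists>y. (x, y) \<in> R} = UNIV"
      by (rule subalgebra_eq_UNIV[OF _ _ _ _ _ _ _ _ _ pq]; use one add smult mul E U V p q in blast)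
    then show "\<exists>y. (x, y) \<in> R" for x by blast
    have "{y. \<exists>x. (x, y) \<in> R} = UNIV"
      by (rule subalgebra_eq_UNIV[OF _ _ _ _ _ _ _ _ _ pq']; use one add smult mul E U V p q in blast)
    then show "\<exists>x. (x, y) \<in> R" for y by blast
  qed
qed

text \<open>If source elements are diagonal, R is part of the identity. Otherwise nondegeneracy
  gives a dual pair of off-diagonal elements on each side, and elements of SL3, which fix
  \<open>E11\<close>, move both pairs to \<open>U1\<close> and \<open>V1\<close>.\<close>

lemma G2_extends_if_E11:
  assumes E: "(E11, E11) \<in> R"
  shows "G2_extends R"
proof (cases "\<forall>(x, y) \<in> R. x = Oct (oa x) 0 0 0 0 0 0 (ob x)")
  case True
  show ?thesis
    by (rule G2_extends_id) (use True diagonal_in[OF E] in \<open>metis (mono_tags, lifting) case_prodD\<close>)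
next
  case False
  then obtain x y where xy: "(x, y) \<in> R" "x \<noteq> Oct (oa x) 0 0 0 0 0 0 (ob x)" by blast
  then consider (u) "ou1 x \<noteq> 0 \<or> ou2 x \<noteq> 0 \<or> ou3 x \<noteq> 0" | (v) "ov1 x \<noteq> 0 \<or> ov2 x \<noteq> 0 \<or> ov3 x \<noteq> 0"
    by (cases x) auto
  then obtain p1 p2 p3 p1' p2' p3' q1 q2 q3 q1' q2' q3' where
    p: "(Oct 0 p1 p2 p3 0 0 0 0, Oct 0 p1' p2' p3' 0 0 0 0) \<in> R" and
    q: "(Oct 0 0 0 0 q1 q2 q3 0, Oct 0 0 0 0 q1' q2' q3' 0) \<in> R" and
    pq: "p1 * q1 + p2 * q2 + p3 * q3 = 1"
  proof cases
    case u
    obtain z z' where z: "(z, z') \<in> R" "otr (omul (Oct 0 (ou1 x) (ou2 x) (ou3 x) 0 0 0 0) z) = 1"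
      by (rule dual_element[OF peirce(1)[OF E xy(1)]]) (use u in \<open>auto simp: ozero_def\<close>)
    then have "ou1 x * ov1 z + ou2 x * ov2 z + ou3 x * ov3 z = 1" by (cases z) simp
    then show thesis by (rule that[OF peirce(1)[OF E xy(1)] peirce(2)[OF E z(1)]])
  next
    case v
    obtain z z' where z: "(z, z') \<in> R" "otr (omul (Oct 0 0 0 0 (ov1 x) (ov2 x) (ov3 x) 0) z) = 1"
      by (rule dual_element[OF peirce(2)[OF E xy(1)]]) (use v in \<open>auto simp: ozero_def\<close>)
    then have "ou1 z * ov1 x + ou2 z * ov2 x + ou3 z * ov3 x = 1" by (cases z) (simp add: mult.commute)
    then show thesis by (rule that[OF peirce(1)[OF E z(1)] peirce(2)[OF E xy(1)]])
  qed
  have pq': "p1' * q1' + p2' * q2' + p3' * q3' = 1" using trace[OF mul[OF p q]] pq by simp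
  obtain g where g: "g \<in> G2"
    "\<And>a s t b. g (Oct a s 0 0 t 0 0 b) = Oct a (s * p1) (s * p2) (s * p3) (t * q1) (t * q2) (t * q3) b"
    using pq by (rule G2_onto_dual_pair) (rule that)
  obtain h where h: "h \<in> G2"
    "\<And>a s t b. h (Oct a s 0 0 t 0 0 b) = Oct a (s * p1') (s * p2') (s * p3') (t * q1') (t * q2') (t * q3') b"
    using pq' by (rule G2_onto_dual_pair) (rule that)
  let ?R = "map_prod (inv g) (inv h) ` R"
  interpret R': oct_isometry ?R by (rule transport[OF G2_inv[OF g(1)] G2_inv[OF h(1)]])
  have in_R': "(x, y) \<in> ?R" if "(g x, h y) \<in> R" for x y
    using that G2_inv_apply(2)[OF g(1), of x] G2_inv_apply(2)[OF h(1), of y] by (force simp: map_prod_def)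
  have "G2_extends ?R"
    by (rule R'.G2_extends_if_M2; rule in_R'; simp add: g(2) h(2) E p q)
  then show ?thesis by (rule G2_extends_transport[OF G2_inv[OF g(1)] G2_inv[OF h(1)]])
qed

end

section \<open>The extension theorem in characteristic 2\<close>

lemma char_2_add_self: "CHAR('a::comm_ring_1) = 2 \<Longrightarrow> (x::'a) + x = 0"
  using of_nat_CHAR[where 'a = 'a] by (simp flip: mult_2)

lemma alg_closed_quadratic_root:
  fixes b c :: "'a::alg_closed_field"
  obtains s where "s * s + b * s + c = 0"
proof -
  obtain s where "poly [:c, b, 1:] s = 0"
    using alg_closed_imp_poly_has_root[of "[:c, b, 1:]"] by auto
  then show thesis by (intro that[of s]) (simp add: algebra_simps)
qed

lemma oct_isometry_G2_extends:
  fixes R :: "('a::alg_closed_field oct \<times> 'a oct) set"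
  assumes "CHAR('a) = 2" and "oct_isometry R"
  shows "G2_extends R"
proof -
  interpret oct_isometry R by fact
  note c2 = char_2_add_self[OF assms(1)]
  show ?thesis
  proof (cases "\<exists>(x, y)\<in>R. otr x \<noteq> 0")
    case True
    then obtain x y where xy: "(x, y) \<in> R" "otr x \<noteq> 0" by blast
    \<comment> \<open>Since tr(s 1) = 2s = 0, the element x + s still has trace tr(x), and its norm
      is s^2 + tr(x) s + n(x). For a root s, dividing by tr(x) gives a nontrivial
      idempotent.\<close>
    obtain s where s: "s * s + otr x * s + onorm x = 0" by (rule alg_closed_quadratic_root)
    let ?e = "\<lambda>z. osmult (inverse (otr x)) (oadd z (osmult s oone))"
    have e: "(?e x, ?e y) \<in> R" by (intro smult add xy one)
    have tr: "otr (?e x) = 1" using xy(2) c2[of s] by (simp add: algebra_simps)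
    have "onorm (oadd x (osmult s oone)) = s * s + otr x * s + onorm x"
      using c2[of "otr x * s"] by (simp add: onorm_oadd opolar_def power2_eq_square algebra_simps)
    then have n: "onorm (?e x) = 0" using s by simp
    obtain g where g: "g \<in> G2" "g (?e x) = E11" using tr n by (rule G2_idempotent_to_E)
    obtain h where h: "h \<in> G2" "h (?e y) = E11"
      using G2_idempotent_to_E[of "?e y"] tr n trace[OF e] norm[OF e] by metis
    interpret R': oct_isometry "map_prod g h ` R" by (rule transport[OF g(1) h(1)])
    have "(E11, E11) \<in> map_prod g h ` R" using imageI[OF e, of "map_prod g h"] g h by simp
    from G2_extends_transport[OF g(1) h(1) R'.G2_extends_if_E11[OF this]] show ?thesis .
  next
    case False
    then have tr0: "otr x = 0" if "(x, y) \<in> R" for x y using that by blast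
    show ?thesis
    proof (rule G2_extends_id)
      fix x y assume xy: "(x, y) \<in> R"
      \<comment> \<open>With s^2 = -n(x) the element x + s has norm 0. As all traces vanish, it is
        orthogonal to the algebra, hence 0, and x is a scalar.\<close>
      obtain s where s: "s * s + 0 * s + onorm x = 0" by (rule alg_closed_quadratic_root)
      let ?z = "\<lambda>x. oadd x (osmult s oone)"
      have z: "(?z x, ?z y) \<in> R" by (intro add smult one xy)
      have "onorm (?z x) = 0"
        using s tr0[OF xy] by (simp add: onorm_oadd opolar_def power2_eq_square algebra_simps)
      moreover have "otr (omul (?z x) w) = 0" if "(w, w') \<in> R" for w w'
        using tr0[OF mul[OF z that]] .
      ultimately have "?z x = ozero"
        using nondeg_fst z unfolding nondegenerate_def by force
      moreover have "osmult s oone = osmult (-1) (osmult s oone)"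
        using c2[of s] by (simp add: oone_def eq_neg_iff_add_eq_0)
      ultimately have "x = osmult s oone" by (metis oadd_osmult_neg)
      then show "(x, x) \<in> R" using smult[OF one] by simp
    qed
  qed
qed

section \<open>Degeneration along one-parameter subgroups\<close>

lemma poly_fun_cong: "f \<in> poly_fun n \<Longrightarrow> (\<And>i. i < n \<Longrightarrow> u i = v i) \<Longrightarrow> f u = f v"
  by (induction rule: poly_fun.induct) auto

lemma inv_ring_apply: "f \<in> inv_ring n \<Longrightarrow> g \<in> G2 \<Longrightarrow> f (\<lambda>i. g (u i)) = f u"
  by (drule inv_ring_def[THEN equalityD1, THEN subsetD])
    (auto dest!: bspec[of _ _ g] spec[of _ "\<lambda>i. g (u i)"] simp: G2_inv_apply)

lemma infinite_UNIV_alg_closed_field: "infinite (UNIV :: 'a::alg_closed_field set)"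
proof
  assume fin: "finite (UNIV :: 'a set)"
  define p where "p = (\<Prod>a\<in>(UNIV :: 'a set). [:- a, 1:]) + 1"
  have "degree (\<Prod>a\<in>(UNIV :: 'a set). [:- a, 1:]) = card (UNIV :: 'a set)"
    by (subst degree_prod_eq_sum_degree) auto
  then have "degree p > 0"
    using fin by (simp add: p_def degree_add_eq_left card_gt_0_iff)
  then obtain x where "poly p x = 0" using alg_closed_imp_poly_has_root by blast
  moreover have "poly p x = 1" using fin by (simp add: p_def poly_prod prod_zero_iff)
  ultimately show False by simp
qed

definition inv_eq :: "nat \<Rightarrow> (nat \<Rightarrow> 'a::comm_ring_1 oct) \<Rightarrow> (nat \<Rightarrow> 'a oct) \<Rightarrow> bool" where
  "inv_eq n u v \<longleftrightarrow> (\<forall>f\<in>inv_ring n. f u = f v)"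

lemma inv_eq_refl: "inv_eq n u u" by (simp add: inv_eq_def)

lemma inv_eq_trans: "inv_eq n u v \<Longrightarrow> inv_eq n v w \<Longrightarrow> inv_eq n u w" unfolding inv_eq_def by metis

lemma inv_eq_G2: "g \<in> G2 \<Longrightarrow> inv_eq n u (\<lambda>i. g (u i))"
  by (simp add: inv_eq_def inv_ring_apply)

lemma poly_fun_along_curve:
  assumes "f \<in> poly_fun n" and "\<And>i j. i < n \<Longrightarrow> j < 8 \<Longrightarrow> \<exists>p. \<forall>t. ocoord j (a t i) = poly p t"
  shows "\<exists>p. \<forall>t. f (a t) = poly p t"
  using assms(1)
proof (induction rule: poly_fun.induct)
  case (const c)
  then show ?case by (intro exI[of _ "[:c:]"]) simp
next
  case (coord i j)
  then show ?case by (rule assms(2))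
next
  case (add f h)
  then obtain p q where "\<forall>t. f (a t) = poly p t" "\<forall>t. h (a t) = poly q t" by blast
  then show ?case by (intro exI[of _ "p + q"]) simp
next
  case (mult f h)
  then obtain p q where "\<forall>t. f (a t) = poly p t" "\<forall>t. h (a t) = poly q t" by blast
  then show ?case by (intro exI[of _ "p * q"]) simp
qed

text \<open>Along the curve an invariant is a polynomial in t that equals its value at u for all t
  \<noteq> 0. The field is infinite, so this polynomial is constant and has the same value at t =
  0.\<close>

lemma inv_eq_limit:
  fixes a :: "'a::alg_closed_field \<Rightarrow> nat \<Rightarrow> 'a oct"
  assumes curve: "\<And>i j. i < n \<Longrightarrow> j < 8 \<Longrightarrow> \<exists>p. \<forall>t. ocoord j (a t i) = poly p t"
    and orbit: "\<And>t. t \<noteq> 0 \<Longrightarrow> \<exists>h\<in>G2. \<forall>i<n. a t i = h (u i)"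
  shows "inv_eq n u (a 0)"
  unfolding inv_eq_def
proof
  fix f :: "(nat \<Rightarrow> 'a oct) \<Rightarrow> 'a" assume f: "f \<in> inv_ring n"
  then have pf: "f \<in> poly_fun n" by (simp add: inv_ring_def)
  obtain p where p: "\<And>t. f (a t) = poly p t" using poly_fun_along_curve[OF pf, of a] curve by blast
  have "f (a t) = f u" if t: "t \<noteq> 0" for t
  proof -
    obtain h where h: "h \<in> G2" "\<forall>i<n. a t i = h (u i)" using orbit[OF t] by blast
    then have "f (a t) = f (\<lambda>i. h (u i))" by (intro poly_fun_cong[OF pf]) simp
    then show ?thesis using inv_ring_apply[OF f h(1)] by simp
  qed
  then have "UNIV - {0} \<subseteq> {t. poly (p - [:f u:]) t = 0}" using p by auto
  moreover have "infinite (UNIV - {0 :: 'a})" using infinite_UNIV_alg_closed_field by simp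
  ultimately have "p - [:f u:] = 0" using poly_roots_finite finite_subset by blast
  then have "poly p 0 = f u" by simp
  then show "f u = f (a 0)" using p by simp
qed

text \<open>The exponents are the nonnegative weights of a one-parameter subgroup of the torus of SL3 on the
  coordinates that do not vanish; a coordinate with a negative weight has to be 0, and its exponent is
  irrelevant.\<close>

lemma inv_eq_torus_limit:
  fixes u :: "nat \<Rightarrow> 'a::alg_closed_field oct"
  assumes torus: "\<And>t. t \<noteq> 0 \<Longrightarrow> x t * y t * z t = (1 :: 'a)"
    and limit: "\<And>i t. i < n \<Longrightarrow> t \<noteq> 0 \<Longrightarrow> osl3 (x t, 0, 0) (0, y t, 0) (0, 0, z t) (u i) =
      Oct (oa (u i)) (t ^ k1 * ou1 (u i)) (t ^ k2 * ou2 (u i)) (t ^ k3 * ou3 (u i))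
        (t ^ l1 * ov1 (u i)) (t ^ l2 * ov2 (u i)) (t ^ l3 * ov3 (u i)) (ob (u i))"
  shows "inv_eq n u (\<lambda>i. Oct (oa (u i)) (0 ^ k1 * ou1 (u i)) (0 ^ k2 * ou2 (u i)) (0 ^ k3 * ou3 (u i))
        (0 ^ l1 * ov1 (u i)) (0 ^ l2 * ov2 (u i)) (0 ^ l3 * ov3 (u i)) (ob (u i)))"
proof (rule inv_eq_limit[where a = "\<lambda>t i. Oct (oa (u i)) (t ^ k1 * ou1 (u i)) (t ^ k2 * ou2 (u i))
    (t ^ k3 * ou3 (u i)) (t ^ l1 * ov1 (u i)) (t ^ l2 * ov2 (u i)) (t ^ l3 * ov3 (u i)) (ob (u i))"])
  have mono: "\<exists>p. \<forall>t. t ^ k * c = poly p t" for k and c :: 'a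
    by (intro exI[of _ "monom c k"]) (simp add: poly_monom)
  show "\<exists>p. \<forall>t. ocoord j (Oct (oa (u i)) (t ^ k1 * ou1 (u i)) (t ^ k2 * ou2 (u i))
      (t ^ k3 * ou3 (u i)) (t ^ l1 * ov1 (u i)) (t ^ l2 * ov2 (u i)) (t ^ l3 * ov3 (u i)) (ob (u i))) = poly p t"
    if "j < 8" for i j
    using that mono[of 0 "oa (u i)"] mono[of 0 "ob (u i)"]
    by (cases rule: less_8_cases) (simp_all only: ocoord_simps mono power_0 mult_1)
next
  fix t :: 'a assume t: "t \<noteq> 0"
  have "osl3 (x t, 0, 0) (0, y t, 0) (0, 0, z t) \<in> G2"
    using torus[OF t] by (intro osl3_G2) (simp add: dot3_def cross3_def mult.assoc)
  then show "\<exists>h\<in>G2. \<forall>i<n. Oct (oa (u i)) (t ^ k1 * ou1 (u i)) (t ^ k2 * ou2 (u i)) (t ^ k3 * ou3 (u i))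
      (t ^ l1 * ov1 (u i)) (t ^ l2 * ov2 (u i)) (t ^ l3 * ov3 (u i)) (ob (u i)) = h (u i)"
    using limit[OF _ t] by (intro bexI[of _ "osl3 (x t, 0, 0) (0, y t, 0) (0, 0, z t)"]) auto
qed

section \<open>Degenerate tuples and their limits\<close>

lemma gen_closed:
  shows gen_one: "oone \<in> gen n u"
    and gen_add: "x \<in> gen n u \<Longrightarrow> y \<in> gen n u \<Longrightarrow> oadd x y \<in> gen n u"
    and gen_omul: "x \<in> gen n u \<Longrightarrow> y \<in> gen n u \<Longrightarrow> omul x y \<in> gen n u"
    and gen_letter: "i < n \<Longrightarrow> u i \<in> gen n u"
proof -
  have "traces_agree n K u u" for K by (simp add: traces_agree_def)
  then show "x \<in> gen n u \<Longrightarrow> y \<in> gen n u \<Longrightarrow> omul x y \<in> gen n u"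
    unfolding gen_def using lncomb_omul[of n u u] by blast
qed (auto simp: gen_def intro: lncomb.one lncomb_add_max lncomb_letter)

lemma gen_subset:
  assumes "oone \<in> P" and "\<And>x y. x \<in> P \<Longrightarrow> y \<in> P \<Longrightarrow> oadd x y \<in> P"
    and "\<And>c x. x \<in> P \<Longrightarrow> osmult c x \<in> P"
    and "\<And>x i. x \<in> P \<Longrightarrow> i < n \<Longrightarrow> omul x (u i) \<in> P"
  shows "gen n u \<subseteq> P"
proof -
  have "lncomb n u u k x y \<Longrightarrow> x \<in> P" for k x y
    by (induction rule: lncomb.induct) (auto intro: assms)
  then show ?thesis by (auto simp: gen_def)
qed

lemma degenerateE:
  fixes u :: "nat \<Rightarrow> 'a::field oct"
  assumes "\<not> nondegenerate (gen n u)"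
  obtains x where "x \<in> gen n u" "x \<noteq> ozero" "otr x = 0" "onorm x = 0"
    "\<And>y. y \<in> gen n u \<Longrightarrow> otr (omul x y) = 0"
proof -
  obtain x where x: "x \<in> gen n u" "x \<noteq> ozero" "onorm x = 0" "\<And>y. y \<in> gen n u \<Longrightarrow> otr (omul x y) = 0"
    using assms unfolding nondegenerate_def by blast
  then show thesis using that[of x] x(4)[OF gen_one] by simp
qed

lemma inv_eq_M2:
  fixes u :: "nat \<Rightarrow> 'a::alg_closed_field oct"
  assumes "\<not> nondegenerate (gen n u)"
  obtains v where "inv_eq n u v"
    "\<And>i. i < n \<Longrightarrow> \<exists>a p q b. v i = Oct a 0 p 0 0 q 0 b"
proof -
  obtain x where x: "x \<in> gen n u" "x \<noteq> ozero" "otr x = 0" "onorm x = 0"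
    "\<And>y. y \<in> gen n u \<Longrightarrow> otr (omul x y) = 0"
    using assms by (rule degenerateE) (rule that)
  obtain g where g: "g \<in> G2" "g x = U1" using x(2-4) by (rule G2_null_to_U1)
  have v1: "ov1 (g b) = 0" if "b \<in> gen n u" for b
  proof -
    have "otr (omul U1 (g b)) = 0"
      using x(5)[OF that] G2_otr[OF g(1), of "omul x b"] by (simp add: G2_omul[OF g(1)] g(2))
    then show ?thesis by (cases "g b") simp
  qed
  \<comment> \<open>For elements whose first v-coordinate is 0, that coordinate of their product is
    the determinant of their second and third u-coordinates. It vanishes too, so all these
    coordinate pairs lie on one line.\<close>
  have u23: "ou2 (g a) * ou3 (g b) = ou3 (g a) * ou2 (g b)" if "a \<in> gen n u" "b \<in> gen n u" for a b
    using v1[OF gen_omul[OF that]] v1[OF that(1)] v1[OF that(2)]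
    by (cases "g a"; cases "g b") (simp add: G2_omul[OF g(1)])
  show thesis
  proof (cases "\<forall>a\<in>gen n u. ou2 (g a) = 0 \<and> ou3 (g a) = 0")
    case True
    let ?u = "\<lambda>i. g (u i)"
    \<comment> \<open>The weights are 2, -1, -1 on u and -2, 1, 1 on v. The coordinates of negative
      weight vanish, and the limit is diagonal.\<close>
    have "inv_eq n ?u (\<lambda>i. Oct (oa (?u i)) (0 ^ 2 * ou1 (?u i)) (0 ^ 0 * ou2 (?u i)) (0 ^ 0 * ou3 (?u i))
        (0 ^ 0 * ov1 (?u i)) (0 ^ 1 * ov2 (?u i)) (0 ^ 1 * ov3 (?u i)) (ob (?u i)))"
    proof (rule inv_eq_torus_limit)
      fix i t assume "i < n" "t \<noteq> (0 :: 'a)"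
      then show "osl3 (t\<^sup>2, 0, 0) (0, inverse t, 0) (0, 0, inverse t) (?u i) =
        Oct (oa (?u i)) (t ^ 2 * ou1 (?u i)) (t ^ 0 * ou2 (?u i)) (t ^ 0 * ou3 (?u i))
        (t ^ 0 * ov1 (?u i)) (t ^ 1 * ov2 (?u i)) (t ^ 1 * ov3 (?u i)) (ob (?u i))"
        using True v1[OF gen_letter, of i] gen_letter[of i n u]
        by (cases "?u i") (auto simp: power2_eq_square)
    qed (simp add: power2_eq_square field_simps)
    from inv_eq_trans[OF inv_eq_G2[OF g(1)] this] show thesis
      by (rule that) (use True v1[OF gen_letter] gen_letter[of _ n u] in auto)
  next
    case False
    then obtain a where a: "a \<in> gen n u" "ou2 (g a) \<noteq> 0 \<or> ou3 (g a) \<noteq> 0" by blast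
    \<comment> \<open>An element of SL3 fixing \<open>U1\<close> turns the line of coordinate pairs
      into ou3 = 0 and keeps ov1 = 0.\<close>
    obtain k where k: "k \<in> G2" "\<And>b. b \<in> gen n u \<Longrightarrow> ov1 (k (g b)) = 0 \<and> ou3 (k (g b)) = 0"
    proof (cases "ou2 (g a) = 0")
      case True
      then have z: "ou2 (g b) = 0" if "b \<in> gen n u" for b using u23[OF a(1) that] a(2) by simp
      show thesis
      proof (rule that)
        show "osl3 (1, 0, 0) (0, 0, -1) (0, 1, 0 :: 'a) \<in> G2"
          by (rule osl3_G2) (simp add: dot3_def cross3_def)
        show "ov1 (osl3 (1, 0, 0) (0, 0, -1) (0, 1, 0) (g b)) = 0 \<and>
            ou3 (osl3 (1, 0, 0) (0, 0, -1) (0, 1, 0) (g b)) = 0" if "b \<in> gen n u" for b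
          using v1[OF that] z[OF that] by (cases "g b") simp
      qed
    next
      case False
      define r where "r = ou3 (g a) / ou2 (g a)"
      have z: "ou3 (g b) = r * ou2 (g b)" if "b \<in> gen n u" for b
        using u23[OF a(1) that] False by (simp add: r_def field_simps)
      show thesis
      proof (rule that)
        show "osl3 (1, 0, 0) (0, 1, - r) (0, 0, 1) \<in> G2"
          by (rule osl3_G2) (simp add: dot3_def cross3_def)
        show "ov1 (osl3 (1, 0, 0) (0, 1, - r) (0, 0, 1) (g b)) = 0 \<and>
            ou3 (osl3 (1, 0, 0) (0, 1, - r) (0, 0, 1) (g b)) = 0" if "b \<in> gen n u" for b
          using v1[OF that] z[OF that] by (cases "g b") simp
      qed
    qed
    let ?u = "\<lambda>i. k (g (u i))"
    \<comment> \<open>The weights are now 1, 0, -1 on u and -1, 0, 1 on v. Only the diagonal and the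
      second coordinates of u and v survive, which form a copy of the 2 by 2 matrices.\<close>
    have "inv_eq n ?u (\<lambda>i. Oct (oa (?u i)) (0 ^ 1 * ou1 (?u i)) (0 ^ 0 * ou2 (?u i)) (0 ^ 0 * ou3 (?u i))
        (0 ^ 0 * ov1 (?u i)) (0 ^ 0 * ov2 (?u i)) (0 ^ 1 * ov3 (?u i)) (ob (?u i)))"
    proof (rule inv_eq_torus_limit)
      fix i t assume "i < n" "t \<noteq> (0 :: 'a)"
      then show "osl3 (t, 0, 0) (0, 1, 0) (0, 0, inverse t) (?u i) =
        Oct (oa (?u i)) (t ^ 1 * ou1 (?u i)) (t ^ 0 * ou2 (?u i)) (t ^ 0 * ou3 (?u i))
        (t ^ 0 * ov1 (?u i)) (t ^ 0 * ov2 (?u i)) (t ^ 1 * ov3 (?u i)) (ob (?u i))"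
        using k(2)[OF gen_letter, of i] by (cases "?u i") auto
    qed simp
    from inv_eq_trans[OF inv_eq_G2[OF G2_comp[OF k(1) g(1)]] this] show thesis
      by (rule that) (use k(2)[OF gen_letter] in auto)
  qed
qed

text \<open>Inside the 2 by 2 matrices, x is a nonzero nilpotent orthogonal to all letters. Once x
  is strictly triangular, all letters are triangular of the same kind, and a torus limit removes
  their off-diagonal entry.\<close>

lemma inv_eq_diagonal:
  fixes u :: "nat \<Rightarrow> 'a::alg_closed_field oct"
  assumes nd: "\<not> nondegenerate (gen n u)"
    and M: "\<And>i. i < n \<Longrightarrow> \<exists>a p q b. u i = Oct a 0 p 0 0 q 0 b"
  obtains v where "inv_eq n u v" "\<And>i. i < n \<Longrightarrow> \<exists>a b. v i = Oct a 0 0 0 0 0 0 b"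
proof -
  obtain x where x: "x \<in> gen n u" "x \<noteq> ozero" "otr x = 0" "onorm x = 0"
    "\<And>y. y \<in> gen n u \<Longrightarrow> otr (omul x y) = 0"
    using nd by (rule degenerateE) (rule that)
  have "gen n u \<subseteq> {x. \<exists>a p q b. x = Oct a 0 p 0 0 q 0 b}"
  proof (rule gen_subset)
    fix x i assume "x \<in> {x. \<exists>a p q b. x = Oct a 0 p 0 0 q 0 (b :: 'a)}" "i < n"
    then show "omul x (u i) \<in> {x. \<exists>a p q b. x = Oct a 0 p 0 0 q 0 b}"
      using M[of i] by auto
  qed (auto simp: oone_def)
  then obtain a p q b where xe: "x = Oct a 0 p 0 0 q 0 b" using x(1) by blast
  have b: "b = - a" using x(3) by (simp add: xe eq_neg_iff_add_eq_0 add.commute)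
  have pq: "a * a + p * q = 0" using x(4) by (simp add: xe b) (metis add.commute add.inverse_inverse diff_0_right minus_diff_eq neg_eq_iff_add_eq_0 diff_eq_eq add_0)
  show thesis
  proof (cases "q = 0")
    case True
    then have "a = 0" "p \<noteq> 0" using pq x(2) by (auto simp: xe b ozero_def)
    then have v2: "ov2 (u i) = 0" if "i < n" for i
      using x(5)[OF gen_letter[OF that]] True \<open>p \<noteq> 0\<close> M[OF that] by (auto simp: xe b)
    have "inv_eq n u (\<lambda>i. Oct (oa (u i)) (0 ^ 0 * ou1 (u i)) (0 ^ 1 * ou2 (u i)) (0 ^ 0 * ou3 (u i))
        (0 ^ 0 * ov1 (u i)) (0 ^ 0 * ov2 (u i)) (0 ^ 0 * ov3 (u i)) (ob (u i)))"
    proof (rule inv_eq_torus_limit)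
      fix i t assume "i < n" "t \<noteq> (0 :: 'a)"
      then show "osl3 (inverse t, 0, 0) (0, t, 0) (0, 0, 1) (u i) =
        Oct (oa (u i)) (t ^ 0 * ou1 (u i)) (t ^ 1 * ou2 (u i)) (t ^ 0 * ou3 (u i))
        (t ^ 0 * ov1 (u i)) (t ^ 0 * ov2 (u i)) (t ^ 0 * ov3 (u i)) (ob (u i))"
        using M[of i] v2[of i] by auto
    qed simp
    then show thesis
      by (rule that) (use M v2 in force)
  next
    case False
    \<comment> \<open>The parameter a / q clears the diagonal (a, -a) of x, and a^2 + pq = 0 then
      makes its entry p vanish. This shift preserves the 2 by 2 matrices.\<close>
    let ?g = "shift 0 (a / q) 0"
    let ?u = "\<lambda>i. ?g (u i)"
    have p0: "p + (a - b - a) * (a / q) = 0" using pq False by (simp add: b field_simps)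
    have gx: "?g x = Oct 0 0 0 0 0 q 0 0"
      using p0 False by (simp add: xe b)
    have gM: "\<exists>c r d. ?u i = Oct c 0 0 0 0 r 0 d" if "i < n" for i
    proof -
      have "otr (omul (?g x) (?u i)) = 0"
        using x(5)[OF gen_letter[OF that]] G2_otr[OF shift_G2, of 0 "a / q" 0 "omul x (u i)"]
        by (simp add: G2_omul[OF shift_G2])
      then have "ou2 (?u i) = 0" using False by (subst (asm) gx, cases "?u i") simp
      moreover have "\<exists>c s r d. ?u i = Oct c 0 s 0 0 r 0 d" using M[OF that] by auto
      ultimately show ?thesis by auto
    qed
    have "inv_eq n ?u (\<lambda>i. Oct (oa (?u i)) (0 ^ 0 * ou1 (?u i)) (0 ^ 0 * ou2 (?u i)) (0 ^ 0 * ou3 (?u i))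
        (0 ^ 0 * ov1 (?u i)) (0 ^ 1 * ov2 (?u i)) (0 ^ 0 * ov3 (?u i)) (ob (?u i)))"
    proof (rule inv_eq_torus_limit)
      fix i t assume "i < n" "t \<noteq> (0 :: 'a)"
      then show "osl3 (t, 0, 0) (0, inverse t, 0) (0, 0, 1) (?u i) =
        Oct (oa (?u i)) (t ^ 0 * ou1 (?u i)) (t ^ 0 * ou2 (?u i)) (t ^ 0 * ou3 (?u i))
        (t ^ 0 * ov1 (?u i)) (t ^ 1 * ov2 (?u i)) (t ^ 0 * ov3 (?u i)) (ob (?u i))"
        using gM[of i] by auto
    qed simp
    from inv_eq_trans[OF inv_eq_G2[OF shift_G2] this] show thesis
      by (rule that) (use gM in force)
  qed
qed

text \<open>The generated algebra is diagonal, and ab = 0 together with a + b = 0 forces a = b =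
  0.\<close>

lemma nondegenerate_diagonal:
  fixes u :: "nat \<Rightarrow> 'a::field oct"
  assumes D: "\<And>i. i < n \<Longrightarrow> \<exists>a b. u i = Oct a 0 0 0 0 0 0 b"
  shows "nondegenerate (gen n u)"
  unfolding nondegenerate_def
proof (intro ballI impI)
  have "gen n u \<subseteq> {x. \<exists>a b. x = Oct a 0 0 0 0 0 0 b}"
  proof (rule gen_subset)
    fix x i assume "x \<in> {x. \<exists>a b. x = Oct a 0 0 0 0 0 0 (b :: 'a)}" "i < n"
    then show "omul x (u i) \<in> {x. \<exists>a b. x = Oct a 0 0 0 0 0 0 b}"
      using D[of i] by auto
  qed (auto simp: oone_def)
  moreover fix x assume x: "x \<in> gen n u" "onorm x = 0" "\<forall>y\<in>gen n u. otr (omul x y) = 0"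
  ultimately obtain a b where "x = Oct a 0 0 0 0 0 0 b" by blast
  moreover have "otr x = 0" using bspec[OF x(3) gen_one] by simp
  ultimately show "x = ozero" using x(2) by (auto simp: ozero_def)
qed

lemma inv_eq_nondegenerate:
  fixes u :: "nat \<Rightarrow> 'a::alg_closed_field oct"
  obtains v where "inv_eq n u v" "nondegenerate (gen n v)"
proof (cases "nondegenerate (gen n u)")
  case True
  then show thesis using that inv_eq_refl by blast
next
  case False
  then obtain v where v: "inv_eq n u v"
    "\<And>i. i < n \<Longrightarrow> \<exists>a p q b. v i = Oct a 0 p 0 0 q 0 b"
    by (rule inv_eq_M2) (rule that)
  show thesis
  proof (cases "nondegenerate (gen n v)")
    case True
    then show thesis using that v(1) by blast
  next
    case False
    obtain w where "inv_eq n v w" "\<And>i. i < n \<Longrightarrow> \<exists>a b. w i = Oct a 0 0 0 0 0 0 b"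
      by (rule inv_eq_diagonal[OF False]) (rule v(2), assumption, rule that)
    then show thesis using that inv_eq_trans[OF v(1)] nondegenerate_diagonal by blast
  qed
qed

section \<open>Separation\<close>

definition poly_oct :: "nat \<Rightarrow> ((nat \<Rightarrow> 'a::comm_ring_1 oct) \<Rightarrow> 'a oct) \<Rightarrow> bool" where
  "poly_oct n X \<longleftrightarrow> (\<forall>j<8. (\<lambda>a. ocoord j (X a)) \<in> poly_fun n)"

lemma poly_fun_diff: "f \<in> poly_fun n \<Longrightarrow> h \<in> poly_fun n \<Longrightarrow> (\<lambda>a. f a - h a) \<in> poly_fun n"
  using poly_fun.add[OF _ poly_fun.mult[OF poly_fun.const[of "-1"]], of f n h] by simp

lemma poly_oct_selectors:
  assumes "poly_oct n X"
  shows "(\<lambda>a. oa (X a)) \<in> poly_fun n" "(\<lambda>a. ou1 (X a)) \<in> poly_fun n" "(\<lambda>a. ou2 (X a)) \<in> poly_fun n"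
    "(\<lambda>a. ou3 (X a)) \<in> poly_fun n" "(\<lambda>a. ov1 (X a)) \<in> poly_fun n" "(\<lambda>a. ov2 (X a)) \<in> poly_fun n"
    "(\<lambda>a. ov3 (X a)) \<in> poly_fun n" "(\<lambda>a. ob (X a)) \<in> poly_fun n"
proof -
  have *: "(\<lambda>a. ocoord j (X a)) \<in> poly_fun n" if "j < 8" for j
    using assms that by (simp add: poly_oct_def)
  show "(\<lambda>a. oa (X a)) \<in> poly_fun n" "(\<lambda>a. ou1 (X a)) \<in> poly_fun n" "(\<lambda>a. ou2 (X a)) \<in> poly_fun n"
    "(\<lambda>a. ou3 (X a)) \<in> poly_fun n" "(\<lambda>a. ov1 (X a)) \<in> poly_fun n" "(\<lambda>a. ov2 (X a)) \<in> poly_fun n"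
    "(\<lambda>a. ov3 (X a)) \<in> poly_fun n" "(\<lambda>a. ob (X a)) \<in> poly_fun n"
    using *[of 0] *[of 1] *[of 2] *[of 3] *[of 4] *[of 5] *[of 6] *[of 7]
    by (simp_all add: ocoord_def)
qed

lemma poly_oct_letter: "i < n \<Longrightarrow> poly_oct n (\<lambda>a. a i)"
  by (simp add: poly_oct_def poly_fun.coord)

lemma poly_oct_omul:
  assumes X: "poly_oct n X" and Y: "poly_oct n Y"
  shows "poly_oct n (\<lambda>a. omul (X a) (Y a))"
  unfolding poly_oct_def
proof (intro allI impI)
  fix j :: nat assume "j < 8"
  have omul_eq: "omul x y = Oct (oa x * oa y + (ou1 x * ov1 y + ou2 x * ov2 y + ou3 x * ov3 y))
       (oa x * ou1 y + ob y * ou1 x - (ov2 x * ov3 y - ov3 x * ov2 y))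
       (oa x * ou2 y + ob y * ou2 x - (ov3 x * ov1 y - ov1 x * ov3 y))
       (oa x * ou3 y + ob y * ou3 x - (ov1 x * ov2 y - ov2 x * ov1 y))
       (oa y * ov1 x + ob x * ov1 y + (ou2 x * ou3 y - ou3 x * ou2 y))
       (oa y * ov2 x + ob x * ov2 y + (ou3 x * ou1 y - ou1 x * ou3 y))
       (oa y * ov3 x + ob x * ov3 y + (ou1 x * ou2 y - ou2 x * ou1 y))
       (ob x * ob y + (ov1 x * ou1 y + ov2 x * ou2 y + ov3 x * ou3 y))" for x y :: "'a oct"
    by (cases x; cases y) simp
  show "(\<lambda>a. ocoord j (omul (X a) (Y a))) \<in> poly_fun n"
    unfolding omul_eq using \<open>j < 8\<close>
    by (cases rule: less_8_cases; simp only: ocoord_simps)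
      (intro poly_fun.add poly_fun.mult poly_fun_diff poly_oct_selectors[OF X] poly_oct_selectors[OF Y])+
qed

lemma poly_oct_rmuls:
  "poly_oct n X \<Longrightarrow> set w \<subseteq> {..<n} \<Longrightarrow> poly_oct n (\<lambda>a. rmuls a (X a) w)"
  by (induction w arbitrary: X) (auto intro!: poly_oct_omul poly_oct_letter)

lemma rmuls_G2: "g \<in> G2 \<Longrightarrow> rmuls (\<lambda>i. g (a i)) (g x) w = g (rmuls a x w)"
  by (induction w arbitrary: x) (simp_all add: G2_omul[symmetric])

lemma S8_subset_inv_ring: "S8 n \<subseteq> (inv_ring n :: ((nat \<Rightarrow> 'a::field oct) \<Rightarrow> 'a) set)"
proof
  fix f :: "(nat \<Rightarrow> 'a oct) \<Rightarrow> 'a" assume "f \<in> S8 n"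
  then consider i where "f = (\<lambda>a. onorm (a i))" "i < n"
    | w where "f = (\<lambda>a. otr (lnprod a w))" "w \<noteq> []" "set w \<subseteq> {..<n}"
    unfolding S8_def by blast
  then show "f \<in> inv_ring n"
  proof cases
    case 1
    have "(\<lambda>a. onorm (a i)) \<in> (poly_fun n :: ((nat \<Rightarrow> 'a oct) \<Rightarrow> 'a) set)"
      unfolding onorm_def dot3_def ovec_u_def ovec_v_def prod.case
      by (intro poly_fun.add poly_fun.mult poly_fun_diff poly_oct_selectors poly_oct_letter 1(2))
    then show ?thesis by (simp add: inv_ring_def 1(1) G2_onorm[OF G2_inv])
  next
    case 2
    have const: "poly_oct n (\<lambda>a. oone :: 'a oct)" by (simp add: poly_oct_def poly_fun.const)
    have f: "f = (\<lambda>a. otr (rmuls a oone w))" by (simp add: 2 lnprod_eq_rmuls)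
    have "(\<lambda>a. otr (rmuls a oone w)) \<in> (poly_fun n :: ((nat \<Rightarrow> 'a oct) \<Rightarrow> 'a) set)"
      unfolding otr_def
      by (intro poly_fun.add poly_oct_selectors poly_oct_rmuls[OF const 2(3)])
    moreover have "otr (rmuls (\<lambda>i. inv g (a i)) oone w) = otr (rmuls a oone w)" if "g \<in> G2"
      for g and a :: "nat \<Rightarrow> 'a oct"
      using rmuls_G2[OF G2_inv[OF that], of a oone w]
      by (simp add: G2_oone[OF G2_inv[OF that]] G2_otr[OF G2_inv[OF that]])
    ultimately show ?thesis by (simp add: inv_ring_def f)
  qed
qed

text \<open>Both projections are the full generated algebras, because every combination of words can
  be evaluated at either tuple.\<close>

lemma oct_isometry_lncomb:
  fixes u v :: "nat \<Rightarrow> 'a::field oct"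
  assumes T: "\<And>K. traces_agree n K u v" and N: "\<And>i. i < n \<Longrightarrow> onorm (u i) = onorm (v i)"
    and "nondegenerate (gen n u)" "nondegenerate (gen n v)"
  shows "oct_isometry {(x, y). \<exists>k. lncomb n u v k x y}"
proof -
  define R where "R = {(x, y). \<exists>k. lncomb n u v k x y}"
  have RI: "lncomb n u v k x y \<Longrightarrow> (x, y) \<in> R" for k x y by (auto simp: R_def)
  have RE: "\<exists>k. lncomb n u v k x y" if "(x, y) \<in> R" for x y using that by (simp add: R_def)
  have "oct_isometry R"
  proof
    show "(oone, oone) \<in> R" by (rule RI[OF lncomb.one])
    have "x \<in> fst ` R \<longleftrightarrow> x \<in> gen n u" for x
    proof
      assume "x \<in> fst ` R"
      then obtain y k where "lncomb n u v k x y" using RE by force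
      from lncomb_fst[OF this] show "x \<in> gen n u" by (auto simp: gen_def)
    next
      assume "x \<in> gen n u"
      then obtain k where "lncomb n u u k x x" by (auto simp: gen_def)
      from lncomb_change_snd[OF this, of v] RI show "x \<in> fst ` R" by force
    qed
    then have "fst ` R = gen n u" by blast
    then show "nondegenerate (fst ` R)" using assms(3) by simp
    have "y \<in> snd ` R \<longleftrightarrow> y \<in> gen n v" for y
    proof
      assume "y \<in> snd ` R"
      then obtain x k where "lncomb n u v k x y" using RE by force
      from lncomb_snd[OF this] show "y \<in> gen n v" by (auto simp: gen_def)
    next
      assume "y \<in> gen n v"
      then obtain k where "lncomb n v v k y y" by (auto simp: gen_def)
      from lncomb_change_fst[OF this, of u] RI show "y \<in> snd ` R" by force
    qed
    then have "snd ` R = gen n v" by blast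
    then show "nondegenerate (snd ` R)" using assms(4) by simp
    fix x y x' y' assume "(x, y) \<in> R"
    then obtain k where k: "lncomb n u v k x y" using RE by blast
    show "(osmult c x, osmult c y) \<in> R" for c by (rule RI[OF lncomb.smult[OF k]])
    show "otr x = otr y" by (rule lncomb_otr[OF T k order_refl])
    show "onorm x = onorm y" by (rule lncomb_onorm[OF T N k order_refl])
    assume "(x', y') \<in> R"
    then obtain l where l: "lncomb n u v l x' y'" using RE by blast
    show "(oadd x x', oadd y y') \<in> R" by (rule RI[OF lncomb_add_max[OF k l]])
    show "(omul x x', omul y y') \<in> R" using lncomb_omul[OF T l k] RI by blast
  qed
  then show ?thesis by (simp add: R_def)
qed

lemma S8_separates_nondegenerate:
  fixes u v :: "nat \<Rightarrow> 'a::alg_closed_field oct"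
  assumes char: "CHAR('a) = 2" and S: "\<And>f. f \<in> S8 n \<Longrightarrow> f u = f v"
    and nd: "nondegenerate (gen n u)" "nondegenerate (gen n v)"
  shows "inv_eq n u v"
proof -
  have N: "onorm (u i) = onorm (v i)" if "i < n" for i
    using S[of "\<lambda>a. onorm (a i)"] that by (auto simp: S8_def)
  have words: "otr (rmuls u oone w) = otr (rmuls v oone w)"
    if "w \<noteq> []" "length w \<le> 8" "sorted_wrt (<) w" "set w \<subseteq> {..<n}" for w
  proof -
    have "(\<lambda>a. otr (lnprod a w)) \<in> (S8 n :: ((nat \<Rightarrow> 'a oct) \<Rightarrow> 'a) set)"
      unfolding S8_def using that by blast
    from S[OF this] show ?thesis by (simp add: lnprod_eq_rmuls[OF that(1)])
  qed
  have "traces_agree n 8 u v"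
    by (rule traces_agree_if_sorted[where K = 8]) (simp_all add: N words)
  from traces_agree_all[OF this N nd(2)] have T: "traces_agree n K u v" for K .
  obtain g where g: "g \<in> G2" "\<forall>(x, y)\<in>{(x, y). \<exists>k. lncomb n u v k x y}. y = g x"
    using oct_isometry_G2_extends[OF char oct_isometry_lncomb[OF T N nd]] unfolding G2_extends_def ..
  have letter: "v i = g (u i)" if "i < n" for i
    using g(2) lncomb_letter[OF that, of u v] by auto
  have "f u = f v" if "f \<in> inv_ring n" for f
  proof -
    have "f v = f (\<lambda>i. g (u i))"
      by (rule poly_fun_cong[of f n]) (use that letter in \<open>simp_all add: inv_ring_def\<close>)
    then show ?thesis using inv_ring_apply[OF that g(1)] by simp
  qed
  then show ?thesis by (simp add: inv_eq_def)
qed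

theorem theorem7p11:
  fixes n :: nat
  assumes "CHAR('a::alg_closed_field) = 2"
    and "n \<ge> 1"
  shows "separating n (S8 n :: ((nat \<Rightarrow> 'a oct) \<Rightarrow> 'a) set)"
  unfolding separating_def
proof (intro conjI allI impI S8_subset_inv_ring)
  fix u v :: "nat \<Rightarrow> 'a oct"
  assume neq: "\<exists>f\<in>inv_ring n. f u \<noteq> f v"
  show "\<exists>f\<in>S8 n. f u \<noteq> f v"
  proof (rule ccontr)
    assume "\<not> ?thesis"
    then have S: "f u = f v" if "f \<in> S8 n" for f using that by blast
    \<comment> \<open>Passing to nondegenerate tuples changes no invariant, in particular none in
      \<open>S8 n\<close>, so the agreement on \<open>S8 n\<close> is inherited.\<close>
    obtain u' where u': "inv_eq n u u'" "nondegenerate (gen n u')" by (rule inv_eq_nondegenerate)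
    obtain v' where v': "inv_eq n v v'" "nondegenerate (gen n v')" by (rule inv_eq_nondegenerate)
    have "f u' = f v'" if "f \<in> S8 n" for f
      using S[OF that] S8_subset_inv_ring that u'(1) v'(1) unfolding inv_eq_def by (metis subsetD)
    then have "inv_eq n u' v'" using S8_separates_nondegenerate[OF assms(1) _ u'(2) v'(2)] by blast
    then show False using neq u'(1) v'(1) unfolding inv_eq_def by metis
  qed
qed

end
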